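(* Let $(\xi,\mu,\eta)$ be a linear representation over $\Sigma=\{a_1,\dots,a_\ell,b\}$ satisfying the standing assumptions in the context, such that the matrix $M=A_1+\cdots+A_\ell+B$ is primitive, and let $\lambda$ be its Perron-Frobenius eigenvalue. Let $\mathbf{Y}_n$ be the associated $\mathbb{R}^\ell$-valued symbol statistics (all defined on one probability space), let $y(\mathbf{t})$ be the Perron-Frobenius eigenvalue of $M(\mathbf{t})=A_1e^{t_1}+\cdots+A_\ell e^{t_\ell}+B$, and let $\boldsymbol{\beta}=\nabla y(\mathbf{0})/\lambda$. Then the sequence $\{\mathbf{Y}_n/n\}$ satisfies a Large Deviation Principle with speed $n$ and good rate function $$G^*(\mathbf{x}) = \sup_{\mathbf{t}\in\mathbb{R}^\ell}\left\{\mathbf{t}\cdot\mathbf{x}-\log\frac{y(\mathbf{t})}{\lambda}\right\},\qquad \mathbf{x}\in\mathbb{R}^\ell.$$ Moreover, $\{\mathbf{Y}_n/n\}$ converges to $\boldsymbol{\beta}$ almost surely.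
   Context: Model. Let $\ell\ge 1$, $m\ge 1$ be integers, $\Sigma=\{a_1,\dots,a_\ell,b\}$ a finite alphabet with $\ell+1$ symbols, $\mathbb{R}_+=[0,\infty)$. Fix column vectors $\xi,\eta\in\mathbb{R}_+^m$ and matrices $A_1,\dots,A_\ell,B\in\mathbb{R}_+^{m\times m}$. Let $\mu$ be the monoid morphism from the set $\Sigma^*$ of all words over $\Sigma$ to $\mathbb{R}_+^{m\times m}$ with $\mu(a_i)=A_i$, $\mu(b)=B$. The triple $(\xi,\mu,\eta)$ is called a linear representation. A prime denotes transposition. Put $M=A_1+\cdots+A_\ell+B$. Standing assumptions: all of $A_1,\dots,A_\ell,B$ are nonzero matrices, and for every sufficiently large $n$ there is a word $w$ of length $n$ with $\xi'\mu(w)\eta>0$ (so $\xi\ne 0\ne\eta$ and $\xi'M^n\eta>0$ for all large $n$). For such $n$, the set $\Sigma^n$ of words of length $n$ carries the probability measure $\Pr(w)=\dfrac{\xi'\mu(w)\eta}{\xi'M^n\eta}$, and $\mathbf{Y}_n=(|w|_{a_1},\dots,|w|_{a_\ell})$, where $w$ is random in $\Sigma^n$ with law $\Pr$ and $|w|_{x}$ is the number of occurrences of $x$ in $w$. Sequences indexed by $n$ are considered for $n$ large enough that $\mathbf{Y}_n$ is defined. The variables $\mathbf{Y}_n$ are assumed to be defined on a common probability space (no assumption on their joint law). A matrix $T\in\mathbb{R}_+^{m\times m}$ is primitive if $T^k$ has all entries strictly positive for some $k\ge 1$; its Perron-Frobenius eigenvalue is its unique eigenvalue of largest modulus, which is real,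 positive and simple. If $M$ is primitive then $M(\mathbf{t})$ is primitive for all $\mathbf{t}\in\mathbb{R}^\ell$; $y(\mathbf{t})$ is a positive function, analytic on $\mathbb{R}^\ell$, with $y(\mathbf{0})=\lambda$. Large deviations. A rate function is a lower semicontinuous map $I:\mathbb{R}^\ell\to[0,\infty]$; it is good if all sets $\{\mathbf{x}: I(\mathbf{x})\le c\}$, $c\ge 0$, are compact. Given positive reals $v_n\to\infty$, a sequence of $\mathbb{R}^\ell$-valued random variables $\{\mathbf{X}_n\}$ satisfies the Large Deviation Principle with speed $v_n$ and rate function $I$ if $\liminf_{n\to\infty}\frac1{v_n}\log P(\mathbf{X}_n\in O)\ge-\inf_{\mathbf{x}\in O}I(\mathbf{x})$ for all open $O\subseteq\mathbb{R}^\ell$ and $\limsup_{n\to\infty}\frac1{v_n}\log P(\mathbf{X}_n\in C)\le-\inf_{\mathbf{x}\in C}I(\mathbf{x})$ for all closed $C\subseteq\mathbb{R}^\ell$. *)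

theory Defs
  imports "HOL-Probability.Probability"
begin

text \<open>The alphabet \<open>{a\<^sub>1, \<dots>, a\<^sub>\<ell>, b}\<close>: the finite nonempty index type \<open>'l\<close> plays the role of
  \<open>{1, \<dots>, \<ell>}\<close>, and the finite index type \<open>'m\<close> of matrices that of \<open>{1, \<dots>, m}\<close>.\<close>

datatype 'l symbol = SymA 'l | SymB

fun letter_matrix :: "('l \<Rightarrow> real^'m^'m) \<Rightarrow> real^'m^'m \<Rightarrow> 'l symbol \<Rightarrow> real^'m^'m" where
  "letter_matrix A B (SymA i) = A i"
| "letter_matrix A B SymB = B"

text \<open>The monoid morphism \<open>\<mu>\<close>. Matrix multiplication is \<open>**\<close>; the symbols \<open>*\<close> and \<open>^\<close> on
  \<open>real^'m^'m\<close> act componentwise and are therefore not used.\<close>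

primrec word_matrix :: "('l \<Rightarrow> real^'m^'m) \<Rightarrow> real^'m^'m \<Rightarrow> 'l symbol list \<Rightarrow> real^'m^'m" where
  "word_matrix A B [] = mat 1"
| "word_matrix A B (x # w) = letter_matrix A B x ** word_matrix A B w"

primrec mat_pow :: "real^'m^'m \<Rightarrow> nat \<Rightarrow> real^'m^'m" where
  "mat_pow T 0 = mat 1"
| "mat_pow T (Suc n) = T ** mat_pow T n"

definition nonneg_vec :: "real^'m \<Rightarrow> bool" where
  "nonneg_vec v \<longleftrightarrow> (\<forall>i. 0 \<le> v $ i)"

definition nonneg_mat :: "real^'m^'m \<Rightarrow> bool" where
  "nonneg_mat T \<longleftrightarrow> (\<forall>i j. 0 \<le> T $ i $ j)"

definition word_weight ::
  "real^'m \<Rightarrow> ('l \<Rightarrow> real^'m^'m) \<Rightarrow> real^'m^'m \<Rightarrow> real^'m \<Rightarrow> 'l symbol list \<Rightarrow> real" where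
  "word_weight \<xi> A B \<eta> w = \<xi> \<bullet> (word_matrix A B w *v \<eta>)"

definition sum_matrix :: "('l::finite \<Rightarrow> real^'m^'m) \<Rightarrow> real^'m^'m \<Rightarrow> real^'m^'m" where
  "sum_matrix A B = (\<Sum>i\<in>UNIV. A i) + B"

definition tilted_matrix :: "('l::finite \<Rightarrow> real^'m^'m) \<Rightarrow> real^'m^'m \<Rightarrow> real^'l \<Rightarrow> real^'m^'m" where
  "tilted_matrix A B t = (\<Sum>i\<in>UNIV. exp (t $ i) *\<^sub>R A i) + B"

definition linear_representation ::
  "real^'m \<Rightarrow> ('l \<Rightarrow> real^'m^'m) \<Rightarrow> real^'m^'m \<Rightarrow> real^'m \<Rightarrow> bool" where
  "linear_representation \<xi> A B \<eta> \<longleftrightarrow>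
     nonneg_vec \<xi> \<and> nonneg_vec \<eta> \<and> (\<forall>i. nonneg_mat (A i)) \<and> nonneg_mat B \<and>
     (\<forall>i. A i \<noteq> 0) \<and> B \<noteq> 0 \<and>
     (\<forall>\<^sub>F n in sequentially. \<exists>w. length w = n \<and> 0 < word_weight \<xi> A B \<eta> w)"

text \<open>The law \<open>Pr\<close> on \<open>\<Sigma>\<^sup>n\<close>, with the discrete sigma-algebra; meaningful
  when the denominator is positive.\<close>

definition word_measure ::
  "real^'m \<Rightarrow> ('l::finite \<Rightarrow> real^'m^'m) \<Rightarrow> real^'m^'m \<Rightarrow> real^'m \<Rightarrow> nat \<Rightarrow> 'l symbol list measure" where
  "word_measure \<xi> A B \<eta> n =
     point_measure {w. length w = n}
       (\<lambda>w. ennreal (word_weight \<xi> A B \<eta> w / (\<xi> \<bullet> (mat_pow (sum_matrix A B) n *v \<eta>))))"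

definition symbol_counts :: "'l symbol list \<Rightarrow> real^'l" where
  "symbol_counts w = (\<chi> i. real (count_list w (SymA i)))"

text \<open>The random vectors \<open>Y n\<close> live on one measure space \<open>P\<close>; only their marginal
  laws, for large \<open>n\<close>, are prescribed.\<close>

definition symbol_statistics ::
  "'w measure \<Rightarrow> real^'m \<Rightarrow> ('l::finite \<Rightarrow> real^'m^'m) \<Rightarrow> real^'m^'m \<Rightarrow> real^'m
     \<Rightarrow> (nat \<Rightarrow> 'w \<Rightarrow> real^'l) \<Rightarrow> bool" where
  "symbol_statistics P \<xi> A B \<eta> Y \<longleftrightarrow>
     (\<forall>\<^sub>F n in sequentially. Y n \<in> borel_measurable P \<and>
        distr P borel (Y n) = distr (word_measure \<xi> A B \<eta> n) borel symbol_counts)"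

definition primitive_mat :: "real^'m^'m \<Rightarrow> bool" where
  "primitive_mat T \<longleftrightarrow> nonneg_mat T \<and> (\<exists>k\<ge>1. \<forall>i j. 0 < mat_pow T k $ i $ j)"

definition is_eigenvalue :: "complex^'m^'m \<Rightarrow> complex \<Rightarrow> bool" where
  "is_eigenvalue T z \<longleftrightarrow> (\<exists>v. v \<noteq> 0 \<and> T *v v = z *s v)"

text \<open>The unique eigenvalue of largest modulus among all complex eigenvalues; it is real.\<close>

definition pf_eigenvalue :: "real^'m^'m \<Rightarrow> real" where
  "pf_eigenvalue T = (THE r.
     is_eigenvalue (map_matrix complex_of_real T) (complex_of_real r) \<and>
     (\<forall>z. is_eigenvalue (map_matrix complex_of_real T) z \<and> z \<noteq> complex_of_real r
        \<longrightarrow> cmod z < cmod (complex_of_real r)))"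

definition gradient :: "('a::real_inner \<Rightarrow> real) \<Rightarrow> 'a \<Rightarrow> 'a" where
  "gradient f x = (THE D. GDERIV f x :> D)"

text \<open>Logarithm of a probability, with \<open>log 0 = -\<infinity>\<close> (the library has \<open>ln 0 = 0\<close>).\<close>

definition log_prob :: "real \<Rightarrow> ereal" where
  "log_prob p = (if p = 0 then -\<infinity> else ereal (ln p))"

definition rate_function :: "('x::topological_space \<Rightarrow> ereal) \<Rightarrow> bool" where
  "rate_function I \<longleftrightarrow>
     (\<forall>x. 0 \<le> I x) \<and> (\<forall>x. \<forall>c < I x. \<forall>\<^sub>F u in nhds x. c < I u)"

definition good_rate_function :: "('x::topological_space \<Rightarrow> ereal) \<Rightarrow> bool" where
  "good_rate_function I \<longleftrightarrow>
     rate_function I \<and> (\<forall>c::real. 0 \<le> c \<longrightarrow> compact {x. I x \<le> ereal c})"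

text \<open>As values are extended reals, the infimum of \<open>I\<close> over the empty set is \<open>\<infinity>\<close>.\<close>

definition satisfies_LDP ::
  "'w measure \<Rightarrow> (nat \<Rightarrow> 'w \<Rightarrow> 'x::topological_space) \<Rightarrow> (nat \<Rightarrow> real) \<Rightarrow> ('x \<Rightarrow> ereal) \<Rightarrow> bool" where
  "satisfies_LDP P X v I \<longleftrightarrow>
     filterlim v at_top sequentially \<and> rate_function I \<and>
     (\<forall>U. open U \<longrightarrow>
        - (INF x\<in>U. I x)
          \<le> liminf (\<lambda>n. log_prob (measure P {\<omega> \<in> space P. X n \<omega> \<in> U}) / ereal (v n))) \<and>
     (\<forall>C. closed C \<longrightarrow>
        limsup (\<lambda>n. log_prob (measure P {\<omega> \<in> space P. X n \<omega> \<in> C}) / ereal (v n))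
          \<le> - (INF x\<in>C. I x))"

end

theory Submission
  imports Defs
begin

text \<open>The moment generating function of \<open>Y n\<close> at \<open>t\<close> is
  \<open>(\<xi> \<bullet> M(t)^n \<eta>) / (\<xi> \<bullet> M^n \<eta>)\<close>, which grows like \<open>(y t / y 0)^n\<close>. As \<open>y\<close> is differentiable, the
  argument of Gaertner and Ellis applies with \<open>L t = ln (y t / y 0)\<close>. The upper bound, and exponential
  concentration of the law tilted by \<open>t\<close> at the gradient \<open>\<nabla>L(t)\<close>, follow from Chernoff's inequality for
  finitely many half-spaces; at \<open>t = 0\<close> the Borel-Cantelli lemma turns the latter into almost sure
  convergence.

  The lower bound near a point \<open>x\<close> of finite rate usually invokes Rockafellar's theorem to make \<open>x\<close>
  a limit of gradients of \<open>L\<close>. Here it is obtained directly: at a maximiser \<open>t\<close> of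
  \<open>t \<bullet> x - L t - (e / 2) * (t \<bullet> t)\<close> the gradient \<open>D = \<nabla>L(t)\<close> is \<open>x - e t\<close>, which tends to \<open>x\<close> as
  \<open>e \<rightarrow> 0\<close>, and \<open>t \<bullet> D - L t\<close> is at most the rate of \<open>x\<close>.

  Perron-Frobenius theory comes from Brouwer's fixed point theorem on the probability simplex.\<close>

section \<open>Large deviations from limits of logarithmic moment generating functions\<close>

text \<open>\<open>Z n\<close> is the unnormalised sequence, hence the division of its logarithmic
  moment generating function by \<open>n\<close>. The conditions are asked eventually, as the law of
  \<open>Y n\<close> is prescribed only for large \<open>n\<close>.\<close>

locale log_mgf_limit = prob_space P for P :: "'w measure" +
  fixes Z :: "nat \<Rightarrow> 'w \<Rightarrow> 'x::euclidean_space" and L :: "'x \<Rightarrow> real"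
  assumes measurable_Z: "\<forall>\<^sub>F n in sequentially. Z n \<in> borel_measurable P"
    and integrable_exp_Z: "\<forall>\<^sub>F n in sequentially. \<forall>t. integrable P (\<lambda>\<omega>. exp (t \<bullet> Z n \<omega>))"
    and log_mgf_tendsto:
      "\<And>t. (\<lambda>n. ln (expectation (\<lambda>\<omega>. exp (t \<bullet> Z n \<omega>))) / real n) \<longlonglongrightarrow> L t"
begin

section \<open>Exponentially tilted laws and Chernoff's inequality\<close>

definition regular :: "nat \<Rightarrow> bool" where
  "regular n \<longleftrightarrow> 0 < n \<and> Z n \<in> borel_measurable P \<and> (\<forall>t. integrable P (\<lambda>\<omega>. exp (t \<bullet> Z n \<omega>)))"

lemma eventually_regular: "eventually regular sequentially"
  unfolding regular_def
  using measurable_Z integrable_exp_Z eventually_gt_at_top[of 0] by eventually_elim simp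

text \<open>The law of \<open>Z n / n\<close> tilted by \<open>t\<close>, before division by its
  total mass \<open>mgf n t\<close>. At \<open>t = 0\<close> it is the law itself, so the same
  estimates serve the upper bound and the change of measure in the lower bound.\<close>

definition tilted_mass :: "nat \<Rightarrow> 'x \<Rightarrow> 'x set \<Rightarrow> real" where
  "tilted_mass n t S = expectation (\<lambda>\<omega>. exp (t \<bullet> Z n \<omega>) * indicator S (Z n \<omega> /\<^sub>R real n))"

abbreviation mgf :: "nat \<Rightarrow> 'x \<Rightarrow> real" where
  "mgf n t \<equiv> tilted_mass n t UNIV"

lemma integrable_tilted:
  assumes "regular n" "S \<in> sets borel"
  shows "integrable P (\<lambda>\<omega>. exp (t \<bullet> Z n \<omega>) * indicator S (Z n \<omega> /\<^sub>R real n))"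
proof (rule Bochner_Integration.integrable_bound)
  show "integrable P (\<lambda>\<omega>. exp (t \<bullet> Z n \<omega>))"
    using assms by (simp add: regular_def)
  have [measurable]: "Z n \<in> borel_measurable P" using assms by (simp add: regular_def)
  note [measurable] = assms(2)
  show "(\<lambda>\<omega>. exp (t \<bullet> Z n \<omega>) * indicator S (Z n \<omega> /\<^sub>R real n)) \<in> borel_measurable P"
    by measurable
qed (auto simp: indicator_def)

lemma tilted_mass_mono:
  assumes "regular n" "S \<in> sets borel" "T \<in> sets borel" "S \<subseteq> T"
  shows "tilted_mass n t S \<le> tilted_mass n t T"
  unfolding tilted_mass_def
  by (intro integral_mono integrable_tilted assms) (use assms(4) in \<open>auto simp: indicator_def\<close>)

lemma tilted_mass_Un:
  assumes "regular n" "S \<in> sets borel" "T \<in> sets borel"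
  shows "tilted_mass n t (S \<union> T) \<le> tilted_mass n t S + tilted_mass n t T"
proof -
  note int = integrable_tilted[OF assms(1), of _ t]
  have "tilted_mass n t (S \<union> T) \<le> expectation (\<lambda>\<omega>. exp (t \<bullet> Z n \<omega>) * indicator S (Z n \<omega> /\<^sub>R real n)
      + exp (t \<bullet> Z n \<omega>) * indicator T (Z n \<omega> /\<^sub>R real n))"
    unfolding tilted_mass_def
    by (intro integral_mono Bochner_Integration.integrable_add int sets.Un assms)
       (auto simp: indicator_def)
  also have "\<dots> = tilted_mass n t S + tilted_mass n t T"
    unfolding tilted_mass_def by (intro Bochner_Integration.integral_add int assms)
  finally show ?thesis .
qed

lemma tilted_mass_Compl:
  assumes "regular n" "S \<in> sets borel"
  shows "tilted_mass n t S = mgf n t - tilted_mass n t (- S)"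
proof -
  have "- S \<in> sets borel" using assms(2) by (metis borel_comp)
  then have "tilted_mass n t S + tilted_mass n t (- S) =
      expectation (\<lambda>\<omega>. exp (t \<bullet> Z n \<omega>) * indicator S (Z n \<omega> /\<^sub>R real n)
        + exp (t \<bullet> Z n \<omega>) * indicator (- S) (Z n \<omega> /\<^sub>R real n))"
    unfolding tilted_mass_def
    by (intro Bochner_Integration.integral_add[symmetric] integrable_tilted assms)
  also have "\<dots> = mgf n t"
    unfolding tilted_mass_def
    by (intro Bochner_Integration.integral_cong) (auto simp: indicator_def)
  finally have "tilted_mass n t S + tilted_mass n t (- S) = mgf n t" .
  then show ?thesis by simp
qed

lemma tilted_mass_zero:
  assumes "regular n" "S \<in> sets borel"
  shows "tilted_mass n 0 S = prob {\<omega> \<in> space P. Z n \<omega> /\<^sub>R real n \<in> S}"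
proof -
  have [measurable]: "Z n \<in> borel_measurable P" using assms by (simp add: regular_def)
  note [measurable] = assms(2)
  have "tilted_mass n 0 S = expectation (indicator {\<omega> \<in> space P. Z n \<omega> /\<^sub>R real n \<in> S})"
    unfolding tilted_mass_def
    by (intro Bochner_Integration.integral_cong) (auto simp: indicator_def)
  also have "\<dots> = prob {\<omega> \<in> space P. Z n \<omega> /\<^sub>R real n \<in> S}"
    by (subst Bochner_Integration.integral_indicator) (auto intro!: arg_cong[where f=prob])
  finally show ?thesis .
qed

lemma mgf_zero: "mgf n 0 = 1"
  by (simp add: tilted_mass_def prob_space)

lemma mgf_pos:
  assumes "regular n"
  shows "0 < mgf n t"
proof -
  have "expectation (\<lambda>\<omega>. 0) < expectation (\<lambda>\<omega>. exp (t \<bullet> Z n \<omega>))"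
    by (rule integral_less_AE_space) (use assms in \<open>auto simp: regular_def emeasure_space_1\<close>)
  then show ?thesis by (simp add: tilted_mass_def)
qed

text \<open>Chernoff's inequality: on the half-space \<open>exp (d \<bullet> Z n)\<close> is at
  least \<open>exp (n a)\<close>, so the additional tilt by \<open>d\<close> can be inserted at the
  price \<open>exp (- n a)\<close>.\<close>

lemma tilted_mass_halfspace_le:
  assumes "regular n"
  shows "tilted_mass n t {z. a \<le> d \<bullet> z} \<le> exp (- (real n * a)) * mgf n (t + d)"
proof -
  have n: "0 < real n" using assms by (simp add: regular_def)
  have "tilted_mass n t {z. a \<le> d \<bullet> z}
      \<le> expectation (\<lambda>\<omega>. exp (- (real n * a)) * (exp ((t + d) \<bullet> Z n \<omega>) * indicator UNIV (Z n \<omega> /\<^sub>R real n)))"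
    unfolding tilted_mass_def
  proof (intro integral_mono integrable_mult_right integrable_tilted assms)
    fix \<omega>
    show "exp (t \<bullet> Z n \<omega>) * indicator {z. a \<le> d \<bullet> z} (Z n \<omega> /\<^sub>R real n)
        \<le> exp (- (real n * a)) * (exp ((t + d) \<bullet> Z n \<omega>) * indicator UNIV (Z n \<omega> /\<^sub>R real n))"
      using n by (auto simp: indicator_def inner_add_left exp_add[symmetric] field_simps)
  qed auto
  then show ?thesis by (simp add: tilted_mass_def)
qed

section \<open>Logarithmic limits and exponential decay\<close>

lemma L_zero: "L 0 = 0"
proof (rule LIMSEQ_unique[OF log_mgf_tendsto])
  show "(\<lambda>n. ln (expectation (\<lambda>\<omega>. exp (0 \<bullet> Z n \<omega>))) / real n) \<longlonglongrightarrow> 0"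
    by (simp add: prob_space)
qed

lemma eventually_mgf_bounds:
  assumes "0 < e"
  shows "\<forall>\<^sub>F n in sequentially. exp (real n * (L t - e)) \<le> mgf n t \<and> mgf n t \<le> exp (real n * (L t + e))"
proof -
  have "(\<lambda>n. ln (mgf n t) / real n) \<longlonglongrightarrow> L t"
    using log_mgf_tendsto[of t] by (simp add: tilted_mass_def)
  then have "\<forall>\<^sub>F n in sequentially. dist (ln (mgf n t) / real n) (L t) < e"
    using assms by (rule tendstoD)
  then show ?thesis using eventually_regular
  proof eventually_elim
    case (elim n)
    have n: "0 < real n" using elim(2) by (simp add: regular_def)
    have "real n * (L t - e) \<le> ln (mgf n t)" "ln (mgf n t) \<le> real n * (L t + e)"
      using elim(1) n by (auto simp: dist_real_def abs_less_iff field_simps)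
    then show ?case using mgf_pos[OF elim(2), of t] by (metis exp_le_cancel_iff exp_ln)
  qed
qed

text \<open>Decay is measured relative to \<open>mgf n t\<close>, that is, for the normalised tilted
  law. The constant \<open>K\<close> makes the notion stable under finite unions.\<close>

definition decays :: "'x \<Rightarrow> real \<Rightarrow> 'x set \<Rightarrow> bool" where
  "decays t c S \<longleftrightarrow> (\<exists>K>0. \<forall>\<^sub>F n in sequentially. tilted_mass n t S \<le> K * exp (- (real n * c)) * mgf n t)"

text \<open>In Chernoff's inequality the quotient \<open>mgf n (t + d) / mgf n t\<close> is
  \<open>exp (n (L (t + d) - L t))\<close> up to subexponential factors, which the strict gap in the
  hypothesis absorbs.\<close>

lemma decays_halfspace:
  assumes c: "c < a + L t - L (t + d)"
  shows "decays t c {z. a \<le> d \<bullet> z}"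
proof -
  \<comment> \<open>Half the gap: the upper estimate of \<open>mgf n (t + d)\<close> and the lower
    one of \<open>mgf n t\<close> cost one \<open>e\<close> each.\<close>
  define e where "e = (a + L t - L (t + d) - c) / 2"
  have e: "0 < e" using c by (simp add: e_def)
  have "\<forall>\<^sub>F n in sequentially. tilted_mass n t {z. a \<le> d \<bullet> z} \<le> 1 * exp (- (real n * c)) * mgf n t"
    using eventually_regular eventually_mgf_bounds[OF e, of t] eventually_mgf_bounds[OF e, of "t + d"]
  proof eventually_elim
    case (elim n)
    have "tilted_mass n t {z. a \<le> d \<bullet> z} \<le> exp (- (real n * a)) * mgf n (t + d)"
      by (rule tilted_mass_halfspace_le[OF elim(1)])
    also have "\<dots> \<le> exp (- (real n * a)) * exp (real n * (L (t + d) + e))"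
      using elim by (intro mult_left_mono) auto
    also have "\<dots> = exp (- (real n * c)) * exp (real n * (L t - e))"
    proof -
      have "- (real n * a) + real n * (L (t + d) + e) = - (real n * c) + real n * (L t - e)"
        by (simp add: e_def field_simps)
      then show ?thesis by (simp only: exp_add[symmetric])
    qed
    also have "\<dots> \<le> exp (- (real n * c)) * mgf n t"
      using elim by (intro mult_left_mono) auto
    finally show ?case by simp
  qed
  then show ?thesis unfolding decays_def by (intro exI[of _ 1]) auto
qed

lemma decays_subset:
  assumes "decays t c T" "S \<subseteq> T" "S \<in> sets borel" "T \<in> sets borel"
  shows "decays t c S"
proof -
  obtain K where K: "0 < K" and ev: "\<forall>\<^sub>F n in sequentially. tilted_mass n t T \<le> K * exp (- (real n * c)) * mgf n t"
    using assms(1) by (auto simp: decays_def)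
  have "\<forall>\<^sub>F n in sequentially. tilted_mass n t S \<le> K * exp (- (real n * c)) * mgf n t"
    using ev eventually_regular
    by eventually_elim (rule order_trans[OF tilted_mass_mono[OF _ assms(3,4,2)]])
  then show ?thesis using K by (auto simp: decays_def)
qed

lemma decays_antimono:
  assumes "decays t c S" "c' \<le> c"
  shows "decays t c' S"
proof -
  obtain K where K: "0 < K" and ev: "\<forall>\<^sub>F n in sequentially. tilted_mass n t S \<le> K * exp (- (real n * c)) * mgf n t"
    using assms(1) by (auto simp: decays_def)
  have "\<forall>\<^sub>F n in sequentially. tilted_mass n t S \<le> K * exp (- (real n * c')) * mgf n t"
    using ev eventually_regular
  proof eventually_elim
    case (elim n)
    have "K * exp (- (real n * c)) * mgf n t \<le> K * exp (- (real n * c')) * mgf n t"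
      using K mgf_pos[OF elim(2), of t] assms(2) by (intro mult_right_mono mult_left_mono) (auto intro: mult_left_mono)
    then show ?case using elim by linarith
  qed
  then show ?thesis using K by (auto simp: decays_def)
qed

lemma decays_Un:
  assumes "decays t c S" "decays t c T" "S \<in> sets borel" "T \<in> sets borel"
  shows "decays t c (S \<union> T)"
proof -
  obtain K where K: "0 < K" and ev: "\<forall>\<^sub>F n in sequentially. tilted_mass n t S \<le> K * exp (- (real n * c)) * mgf n t"
    using assms(1) by (auto simp: decays_def)
  obtain K' where K': "0 < K'" and ev': "\<forall>\<^sub>F n in sequentially. tilted_mass n t T \<le> K' * exp (- (real n * c)) * mgf n t"
    using assms(2) by (auto simp: decays_def)
  have "\<forall>\<^sub>F n in sequentially. tilted_mass n t (S \<union> T) \<le> (K + K') * exp (- (real n * c)) * mgf n t"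
    using ev ev' eventually_regular
  proof eventually_elim
    case (elim n)
    then show ?case using tilted_mass_Un[OF elim(3) assms(3,4), of t]
      by (simp add: algebra_simps)
  qed
  then show ?thesis using K K' by (auto simp: decays_def intro!: exI[of _ "K + K'"])
qed

lemma decays_empty: "decays t c {}"
  unfolding decays_def
  by (intro exI[of _ 1] conjI eventually_mono[OF eventually_regular])
     (use mgf_pos in \<open>auto simp: tilted_mass_def intro!: less_imp_le\<close>)

lemma decays_UN:
  assumes "finite V" "\<And>v. v \<in> V \<Longrightarrow> decays t c (S v)" "\<And>v. v \<in> V \<Longrightarrow> S v \<in> sets borel"
  shows "decays t c (\<Union>v\<in>V. S v)"
  using assms
proof (induction V rule: finite_induct)
  case empty
  then show ?case by (simp add: decays_empty)
next
  case (insert v V)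
  then show ?case by (simp, intro decays_Un) auto
qed

end

section \<open>Concentration of the tilted law at the gradient\<close>

lemma borel_halfspace: "{z::'a::euclidean_space. a \<le> d \<bullet> z} \<in> sets borel"
  by (intro borel_closed closed_halfspace_ge)

text \<open>Finitely many test directions that bound the norm, so that half-spaces in these
  directions cover the complement of a bounded set.\<close>

definition signed_basis :: "'a::euclidean_space set" where
  "signed_basis = Basis \<union> uminus ` Basis"

lemma finite_signed_basis: "finite signed_basis"
  by (simp add: signed_basis_def)

lemma signed_basis_bound:
  fixes z :: "'a::euclidean_space" and r :: real
  assumes "\<And>v. v \<in> signed_basis \<Longrightarrow> v \<bullet> z \<le> r"
  shows "norm z \<le> DIM('a) * r"
proof -
  have "norm z \<le> (\<Sum>b\<in>Basis. \<bar>z \<bullet> b\<bar>)" by (rule norm_le_l1)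
  also have "\<dots> \<le> (\<Sum>b\<in>(Basis::'a set). r)"
  proof (rule sum_mono)
    fix b :: 'a assume "b \<in> Basis"
    then show "\<bar>z \<bullet> b\<bar> \<le> r" using assms[of b] assms[of "- b"]
      by (auto simp: signed_basis_def inner_commute)
  qed
  finally show ?thesis by simp
qed

text \<open>The difference quotient along \<open>v\<close> tends to \<open>v \<bullet> D\<close>. A
  single positive \<open>s\<close> is enough: it is the tilt that gives a half-space beyond
  \<open>D\<close> a positive Chernoff exponent.\<close>

lemma GDERIV_increment:
  assumes D: "GDERIV f t :> D" and d: "0 < d"
  shows "\<exists>s>0. f (t + s *\<^sub>R v) - f t < s * (v \<bullet> D + d)"
proof -
  have "((\<lambda>s::real. f (t + s *\<^sub>R v)) has_derivative (\<lambda>h. (h *\<^sub>R v) \<bullet> D)) (at 0)"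
    by (rule has_derivative_compose[where f="\<lambda>s. t + s *\<^sub>R v"])
       (use D in \<open>auto simp: gderiv_def intro!: derivative_eq_intros\<close>)
  then have "((\<lambda>s::real. f (t + s *\<^sub>R v)) has_field_derivative (v \<bullet> D)) (at 0)"
    by (rule has_derivative_imp_has_field_derivative) simp
  then have "((\<lambda>s. (f (t + s *\<^sub>R v) - f t) / s) \<longlongrightarrow> v \<bullet> D) (at 0)"
    by (simp add: has_field_derivative_iff)
  then have "((\<lambda>s. (f (t + s *\<^sub>R v) - f t) / s) \<longlongrightarrow> v \<bullet> D) (at_right 0)"
    by (rule filterlim_mono) (auto simp: at_within_le_at)
  then have "\<forall>\<^sub>F s in at_right 0. (f (t + s *\<^sub>R v) - f t) / s < v \<bullet> D + d"
    by (rule order_tendstoD) (use d in auto)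
  moreover have "\<forall>\<^sub>F s in at_right (0::real). 0 < s" by (simp add: eventually_at_right_less)
  ultimately have "\<forall>\<^sub>F s in at_right (0::real). 0 < s \<and> f (t + s *\<^sub>R v) - f t < s * (v \<bullet> D + d)"
    by eventually_elim (simp add: field_simps)
  then show ?thesis using eventually_happens[of _ "at_right (0::real)"] trivial_limit_at_right_real by blast
qed

context log_mgf_limit
begin

text \<open>A point outside the ball exceeds \<open>D\<close> by \<open>d\<close> in some signed
  basis direction \<open>v\<close>. The corresponding half-space decays by Chernoff's inequality
  with a small tilt along \<open>v\<close>.\<close>

lemma decays_outside_ball:
  assumes D: "GDERIV L t :> D" and r: "0 < r"
  shows "\<exists>c>0. decays t c (- ball D r)"
proof -
  \<comment> \<open>Chosen so that \<open>DIM('x) * d = r / 2\<close>: by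
    \<open>signed_basis_bound\<close>, a point within \<open>d\<close> in every signed direction
    lies in the ball.\<close>
  define d where "d = r / (2 * DIM('x))"
  have d: "0 < d" using r by (simp add: d_def)
  have "\<exists>c>0. decays t c {z. v \<bullet> D + d \<le> v \<bullet> z}" for v
  proof -
    obtain s where s: "0 < s" "L (t + s *\<^sub>R v) - L t < s * (v \<bullet> D + d)"
      using GDERIV_increment[OF D d] by blast
    \<comment> \<open>Half of the Chernoff exponent of the tilt \<open>s *\<^sub>R v\<close>, which
      leaves the inequality required by \<open>decays_halfspace\<close> strict.\<close>
    define c where "c = (s * (v \<bullet> D + d) - (L (t + s *\<^sub>R v) - L t)) / 2"
    have "decays t c {z. s * (v \<bullet> D + d) \<le> (s *\<^sub>R v) \<bullet> z}"
      by (rule decays_halfspace) (use s in \<open>simp add: c_def field_simps\<close>)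
    moreover have "{z. s * (v \<bullet> D + d) \<le> (s *\<^sub>R v) \<bullet> z} = {z. v \<bullet> D + d \<le> v \<bullet> z}"
      using s(1) by auto
    ultimately show ?thesis using s(2) by (intro exI[of _ c]) (auto simp: c_def)
  qed
  then obtain c where c: "\<And>v. 0 < c v" "\<And>v. decays t (c v) {z. v \<bullet> D + d \<le> v \<bullet> z}"
    by metis
  define c0 where "c0 = Min (insert 1 (c ` signed_basis))"
  have c0: "0 < c0" "\<And>v. v \<in> signed_basis \<Longrightarrow> c0 \<le> c v"
    using c(1) finite_signed_basis[where 'a='x] by (auto simp: c0_def)
  have "decays t c0 (\<Union>v\<in>signed_basis. {z. v \<bullet> D + d \<le> v \<bullet> z})"
    by (intro decays_UN finite_signed_basis borel_halfspace) (rule decays_antimono[OF c(2) c0(2)])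
  moreover have "- ball D r \<subseteq> (\<Union>v\<in>signed_basis. {z. v \<bullet> D + d \<le> v \<bullet> z})"
  proof
    fix z assume z: "z \<in> - ball D r"
    show "z \<in> (\<Union>v\<in>signed_basis. {z. v \<bullet> D + d \<le> v \<bullet> z})"
    proof (rule ccontr)
      assume "\<not> ?thesis"
      then have "v \<bullet> (z - D) \<le> d" if "v \<in> signed_basis" for v
        using that by (force simp: inner_diff_right)
      then have "norm (z - D) \<le> DIM('x) * d" by (rule signed_basis_bound)
      also have "\<dots> < r" using r by (simp add: d_def)
      finally show False using z by (simp add: dist_norm norm_minus_commute)
    qed
  qed
  ultimately have "decays t c0 (- ball D r)"
    by (rule decays_subset) (auto intro!: borel_closed closed_halfspace_ge finite_signed_basis sets.finite_UN)
  then show ?thesis using c0(1) by blast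
qed

text \<open>At \<open>t = 0\<close> the decay concerns probabilities and is summable, so
  Borel-Cantelli applies whatever the joint law. Countably many radii suffice for
  convergence.\<close>

lemma AE_tendsto_gradient:
  assumes D: "GDERIV L 0 :> D"
  shows "AE \<omega> in P. (\<lambda>n. Z n \<omega> /\<^sub>R real n) \<longlonglongrightarrow> D"
proof -
  have *: "AE \<omega> in P. \<forall>\<^sub>F n in sequentially. Z n \<omega> /\<^sub>R real n \<in> ball D r" if r: "0 < r" for r
  proof -
    obtain c K where c: "0 < c" and K: "0 < K"
      and ev: "\<forall>\<^sub>F n in sequentially. tilted_mass n 0 (- ball D r) \<le> K * exp (- (real n * c))"
      using decays_outside_ball[OF D r] by (auto simp: decays_def mgf_zero)
    \<comment> \<open>Emptied where \<open>n\<close> is not regular, since the event might not be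
      measurable there; this affects finitely many \<open>n\<close>.\<close>
    define S where "S n = (if regular n then {\<omega> \<in> space P. Z n \<omega> /\<^sub>R real n \<in> - ball D r} else {})" for n
    have S: "S n \<in> events" for n
    proof (cases "regular n")
      case True
      then have [measurable]: "Z n \<in> borel_measurable P" by (simp add: regular_def)
      show ?thesis by (simp add: S_def)
    qed (simp add: S_def)
    have "summable (\<lambda>n. prob (S n))"
    proof (rule summable_comparison_test_ev)
      show "summable (\<lambda>n. K * exp (- c) ^ n)"
        using c by (intro summable_mult summable_geometric) auto
      show "\<forall>\<^sub>F n in sequentially. norm (prob (S n)) \<le> K * exp (- c) ^ n"
        using ev eventually_regular
      proof eventually_elim
        case (elim n)
        have "prob (S n) = tilted_mass n 0 (- ball D r)"
          using elim(2) by (subst tilted_mass_zero) (auto simp: S_def)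
        then have "prob (S n) \<le> K * exp (- c) ^ n"
          using elim(1) by (simp add: exp_of_nat_mult[symmetric])
        then show ?case by simp
      qed
    qed
    then have "AE \<omega> in P. \<forall>\<^sub>F n in sequentially. \<omega> \<in> space P - S n"
      by (intro borel_cantelli_AE1 S) (auto simp: emeasure_eq_measure)
    then show ?thesis
    proof (rule AE_mp, intro AE_I2 impI)
      fix \<omega> assume "\<omega> \<in> space P" "\<forall>\<^sub>F n in sequentially. \<omega> \<in> space P - S n"
      from this(2) eventually_regular show "\<forall>\<^sub>F n in sequentially. Z n \<omega> /\<^sub>R real n \<in> ball D r"
        by eventually_elim (auto simp: S_def)
    qed
  qed
  have "AE \<omega> in P. \<forall>k. \<forall>\<^sub>F n in sequentially. Z n \<omega> /\<^sub>R real n \<in> ball D (inverse (real (Suc k)))"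
    unfolding AE_all_countable by (intro allI *) auto
  then show ?thesis
  proof (rule AE_mp, intro AE_I2 impI tendstoI)
    fix \<omega> and e :: real
    assume k: "\<forall>k. \<forall>\<^sub>F n in sequentially. Z n \<omega> /\<^sub>R real n \<in> ball D (inverse (real (Suc k)))" and "0 < e"
    obtain k where e: "inverse (real (Suc k)) < e" using \<open>0 < e\<close> reals_Archimedean by blast
    from k have "\<forall>\<^sub>F n in sequentially. Z n \<omega> /\<^sub>R real n \<in> ball D (inverse (real (Suc k)))" by blast
    then show "\<forall>\<^sub>F n in sequentially. dist (Z n \<omega> /\<^sub>R real n) D < e"
      by eventually_elim (use e in \<open>auto simp: dist_commute\<close>)
  qed
qed

section \<open>The convex conjugate of \<open>L\<close> as rate function, and the upper
  bound\<close>

definition rate :: "'x \<Rightarrow> ereal" where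
  "rate x = (SUP t. ereal (t \<bullet> x - L t))"

lemma rate_ge: "ereal (t \<bullet> x - L t) \<le> rate x"
  unfolding rate_def by (rule SUP_upper) simp

lemma rate_nonneg: "0 \<le> rate x"
  using rate_ge[of 0 x] by (simp add: L_zero zero_ereal_def)

text \<open>A supremum of continuous functions is lower semicontinuous. Sublevel sets are
  intersections of closed half-spaces, and those in the signed basis directions already bound
  them.\<close>

lemma good_rate_function_rate: "good_rate_function rate"
proof -
  have "\<forall>\<^sub>F u in nhds x. c < rate u" if lt: "c < rate x" for x c
  proof -
    obtain t where t: "c < ereal (t \<bullet> x - L t)"
      using lt by (auto simp: rate_def less_SUP_iff)
    have "((\<lambda>u. ereal (t \<bullet> u - L t)) \<longlongrightarrow> ereal (t \<bullet> x - L t)) (nhds x)"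
      by (auto intro!: tendsto_intros simp: filterlim_ident)
    then have "\<forall>\<^sub>F u in nhds x. c < ereal (t \<bullet> u - L t)"
      using t by (rule order_tendstoD)
    then show ?thesis by eventually_elim (rule less_le_trans[OF _ rate_ge])
  qed
  moreover have "compact {x. rate x \<le> ereal c}" for c
  proof -
    have eq: "{x. rate x \<le> ereal c} = (\<Inter>t. {x. t \<bullet> x \<le> c + L t})"
      by (auto simp: rate_def SUP_le_iff algebra_simps)
    have "closed {x. rate x \<le> ereal c}"
      unfolding eq by (intro closed_INT ballI closed_halfspace_le)
    moreover have "bounded {x. rate x \<le> ereal c}"
    proof -
      define r where "r = Max ((\<lambda>v. c + L v) ` signed_basis)"
      have "norm x \<le> DIM('x) * r" if "rate x \<le> ereal c" for x
      proof (rule signed_basis_bound)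
        fix v :: 'x assume v: "v \<in> signed_basis"
        have "v \<bullet> x \<le> c + L v" using that eq by blast
        also have "\<dots> \<le> r" using v finite_signed_basis[where 'a='x] by (auto simp: r_def)
        finally show "v \<bullet> x \<le> r" .
      qed
      then show ?thesis by (auto simp: bounded_iff)
    qed
    ultimately show ?thesis by (simp add: compact_eq_bounded_closed)
  qed
  ultimately show ?thesis
    using rate_nonneg by (simp add: good_rate_function_def rate_function_def)
qed

text \<open>The half-spaces for \<open>t \<in> signed_basis\<close> cover the complement of a bounded set, so that
  finitely many half-spaces cover \<open>C\<close> even if \<open>C\<close> is unbounded.\<close>

lemma decays_closed:
  assumes C: "closed C" and a: "\<And>x. x \<in> C \<Longrightarrow> ereal b < rate x" and ab: "a < b"
  shows "decays 0 a C"
proof -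
  \<comment> \<open>The open half-space on which \<open>t\<close> alone witnesses a rate above
    \<open>b\<close>; its probability decays at the smaller rate \<open>a\<close>.\<close>
  define H where "H t = {z. L t + b < t \<bullet> z}" for t
  define K where "K = (\<Inter>v\<in>signed_basis. {z. v \<bullet> z \<le> L v + b})"
  have H_eq: "decays 0 a (H t)" and H_borel: "H t \<in> sets borel" and H_open: "open (H t)" for t
  proof -
    show *: "open (H t)" unfolding H_def by (rule open_halfspace_gt)
    then show "H t \<in> sets borel" by simp
    moreover have "decays 0 a {z. L t + b \<le> t \<bullet> z}"
      by (rule decays_halfspace) (use ab in \<open>simp add: L_zero\<close>)
    ultimately show "decays 0 a (H t)"
      by (rule_tac decays_subset) (auto simp: H_def intro!: borel_halfspace)
  qed
  have "compact (C \<inter> K)"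
  proof -
    have "closed K" unfolding K_def by (intro closed_INT ballI closed_halfspace_le)
    moreover have "bounded K"
    proof -
      define r where "r = Max ((\<lambda>v. L v + b) ` signed_basis)"
      have "norm x \<le> DIM('x) * r" if "x \<in> K" for x
      proof (rule signed_basis_bound)
        fix v :: 'x assume v: "v \<in> signed_basis"
        have "v \<bullet> x \<le> L v + b" using that v by (auto simp: K_def)
        also have "\<dots> \<le> r" using v finite_signed_basis[where 'a='x] by (auto simp: r_def)
        finally show "v \<bullet> x \<le> r" .
      qed
      then show ?thesis by (auto simp: bounded_iff)
    qed
    ultimately show ?thesis using C by (intro closed_Int_compact) (auto simp: compact_eq_bounded_closed)
  qed
  moreover have "C \<inter> K \<subseteq> (\<Union>t\<in>UNIV. H t)"
  proof
    fix x assume "x \<in> C \<inter> K"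
    then have "ereal b < rate x" using a by blast
    then obtain t where "ereal b < ereal (t \<bullet> x - L t)" by (auto simp: rate_def less_SUP_iff)
    then have "x \<in> H t" by (simp add: H_def)
    then show "x \<in> (\<Union>t\<in>UNIV. H t)" by blast
  qed
  ultimately obtain F where F: "finite F" "C \<inter> K \<subseteq> (\<Union>t\<in>F. H t)"
    using H_open by (metis compactE_image)
  have sub: "C \<subseteq> (\<Union>t\<in>F \<union> signed_basis. H t)"
    using F(2) by (force simp: K_def H_def not_le)
  have "decays 0 a (\<Union>t\<in>F \<union> signed_basis. H t)"
    using F(1) finite_signed_basis by (intro decays_UN H_eq H_borel) auto
  then show ?thesis
    by (rule decays_subset[OF _ sub]) (use C H_open in \<open>auto intro!: borel_open open_Un open_UN\<close>)
qed

text \<open>Each real \<open>a\<close> below the infimum yields the bound \<open>- a\<close>, as the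
  constant \<open>K\<close> disappears on the scale \<open>n\<close>. Approaching by reals also
  covers an infinite infimum, in particular an empty \<open>C\<close>.\<close>

lemma LDP_upper_bound:
  assumes C: "closed C"
  shows "limsup (\<lambda>n. log_prob (prob {\<omega> \<in> space P. Z n \<omega> /\<^sub>R real n \<in> C}) / ereal (real n))
    \<le> - (INF x\<in>C. rate x)"
proof -
  let ?p = "\<lambda>n. prob {\<omega> \<in> space P. Z n \<omega> /\<^sub>R real n \<in> C}"
  have *: "limsup (\<lambda>n. log_prob (?p n) / ereal (real n)) \<le> - ereal a"
    if a: "ereal a < (INF x\<in>C. rate x)" for a
  proof -
    obtain b where b: "a < b" "ereal b < (INF x\<in>C. rate x)"
      using ereal_dense2[OF a] by auto
    have "decays 0 a C"
      by (rule decays_closed[OF C _ b(1)]) (use b(2) in \<open>auto dest: less_INF_D\<close>)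
    then obtain K where K: "0 < K"
      and ev: "\<forall>\<^sub>F n in sequentially. tilted_mass n 0 C \<le> K * exp (- (real n * a))"
      by (auto simp: decays_def mgf_zero)
    have "\<forall>\<^sub>F n in sequentially. log_prob (?p n) / ereal (real n) \<le> ereal (ln K / real n - a)"
      using ev eventually_regular
    proof eventually_elim
      case (elim n)
      have n: "0 < real n" using elim(2) by (simp add: regular_def)
      have p: "?p n \<le> K * exp (- (real n * a))"
        using elim C by (simp add: tilted_mass_zero)
      show ?case
      proof (cases "?p n = 0")
        case True
        then show ?thesis using n by (simp add: log_prob_def)
      next
        case False
        then have "0 < ?p n" by (simp add: zero_less_measure_iff)
        then have "ln (?p n) \<le> ln (K * exp (- (real n * a)))" using p by simp
        also have "\<dots> = ln K - real n * a" using K by (simp add: ln_mult)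
        finally have "ln (?p n) / real n \<le> ln K / real n - a" using n by (simp add: field_simps)
        then show ?thesis using False n by (simp add: log_prob_def)
      qed
    qed
    then have "limsup (\<lambda>n. log_prob (?p n) / ereal (real n)) \<le> limsup (\<lambda>n. ereal (ln K / real n - a))"
      by (rule Limsup_mono)
    also have "\<dots> = ereal (- a)"
    proof (rule lim_imp_Limsup)
      have "(\<lambda>n. ln K / real n - a) \<longlonglongrightarrow> 0 - a"
        by (intro tendsto_intros lim_const_over_n)
      then show "(\<lambda>n. ereal (ln K / real n - a)) \<longlonglongrightarrow> ereal (- a)" by simp
    qed simp
    finally show ?thesis by simp
  qed
  show ?thesis
  proof (rule ccontr)
    assume "\<not> ?thesis"
    then obtain z where z: "- (INF x\<in>C. rate x) < ereal z"
        "ereal z < limsup (\<lambda>n. log_prob (?p n) / ereal (real n))"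
      by (meson ereal_dense2 not_le)
    have "ereal (- z) < (INF x\<in>C. rate x)"
      using z(1) by (simp add: ereal_uminus_less_reorder flip: uminus_ereal.simps)
    from *[OF this] z(2) show False by simp
  qed
qed

section \<open>The lower bound by change of measure\<close>

text \<open>The quadratic penalty forces a maximiser to exist even if the supremum defining
  \<open>rate x\<close> is not attained. Finiteness of the rate allows \<open>e\<close> to be chosen
  so that the shift \<open>e t\<close> of the gradient is shorter than \<open>r\<close>.\<close>

lemma exists_tilt_near:
  assumes diff: "\<And>t. \<exists>D. GDERIV L t :> D"
    and x: "rate x < \<infinity>" and r: "0 < r"
  shows "\<exists>t D. GDERIV L t :> D \<and> dist D x < r \<and> ereal (t \<bullet> D - L t) \<le> rate x"
proof -
  obtain g where g: "rate x = ereal g" and g0: "0 \<le> g"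
    using x rate_nonneg[of x] by (cases "rate x") auto
  have gt: "t \<bullet> x - L t \<le> g" for t using rate_ge[of t x] g by simp
  obtain e where e: "0 < e" "2 * e * g < r\<^sup>2"
  proof
    \<comment> \<open>For this witness \<open>2 * e * g\<close> equals
      \<open>r\<^sup>2 * g / (g + 1)\<close>; the \<open>1\<close> keeps the denominator positive
      when \<open>g = 0\<close>.\<close>
    show "0 < r\<^sup>2 / (2 * g + 2)" using r g0 by simp
    show "2 * (r\<^sup>2 / (2 * g + 2)) * g < r\<^sup>2"
      using r g0 by (simp add: field_simps)
  qed
  define f where "f t = t \<bullet> x - L t - e / 2 * (t \<bullet> t)" for t
  have f_deriv: "GDERIV f t :> x - D - e *\<^sub>R t" if "GDERIV L t :> D" for t D
    using that unfolding f_def gderiv_def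
    by (auto intro!: derivative_eq_intros simp: algebra_simps inner_commute)
  have "isCont f t" for t
  proof -
    obtain D where "GDERIV L t :> D" using diff by blast
    from f_deriv[OF this] show ?thesis unfolding gderiv_def by (rule has_derivative_continuous)
  qed
  then have "continuous_on UNIV f" by (simp add: continuous_at_imp_continuous_on)
  define R where "R = r / e"
  have "compact (cball (0::'x) R)" "cball (0::'x) R \<noteq> {}" "continuous_on (cball 0 R) f"
    using \<open>continuous_on UNIV f\<close> less_imp_le[OF divide_pos_pos[OF r e(1)]]
    by (auto simp: R_def not_less intro: continuous_on_subset)
  then obtain t where t: "t \<in> cball 0 R" "\<And>s. s \<in> cball 0 R \<Longrightarrow> f s \<le> f t"
    using continuous_attains_sup[of "cball 0 R" f] by auto
  have f0: "f 0 = 0" by (simp add: f_def L_zero)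
  \<comment> \<open>As \<open>f 0 = 0\<close>, only points with \<open>0 \<le> f s\<close> compete
    for the maximum. They all lie in the ball of radius \<open>R\<close>, so the maximum over this
    compact ball is global.\<close>
  have nonneg_imp: "e * norm s < r" if "0 \<le> f s" for s
  proof -
    have "e / 2 * (s \<bullet> s) \<le> g" using that gt[of s] by (simp add: f_def)
    then have "e * (e / 2 * (s \<bullet> s)) \<le> e * g" using e(1) by (intro mult_left_mono) auto
    moreover have "(e * norm s)\<^sup>2 = 2 * (e * (e / 2 * (s \<bullet> s)))"
      by (simp add: power2_norm_eq_inner power_mult_distrib) (simp add: power2_eq_square)
    ultimately have "(e * norm s)\<^sup>2 \<le> 2 * e * g" by linarith
    then have "(e * norm s)\<^sup>2 < r\<^sup>2" using e(2) by linarith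
    then show ?thesis by (rule power_less_imp_less_base) (use r in simp)
  qed
  have max: "f s \<le> f t" for s
  proof (cases "0 \<le> f s")
    case True
    then have "norm s \<le> R" using nonneg_imp[OF True] e by (simp add: R_def field_simps)
    then show ?thesis using t(2) by auto
  next
    case False
    then show ?thesis using t(2)[of 0] f0 r e by (auto simp: R_def)
  qed
  obtain D where D: "GDERIV L t :> D" using diff by blast
  have "(\<lambda>h. h \<bullet> (x - D - e *\<^sub>R t)) = (\<lambda>h. 0)"
    using f_deriv[OF D] unfolding gderiv_def by (rule has_derivative_local_max) (use max in auto)
  then have "(x - D - e *\<^sub>R t) \<bullet> (x - D - e *\<^sub>R t) = 0" by (rule fun_cong)
  then have "x - D - e *\<^sub>R t = 0" by (simp only: inner_eq_zero_iff)
  then have Deq: "D = x - e *\<^sub>R t" by (simp add: algebra_simps)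
  have "0 \<le> f t" using max[of 0] f0 by simp
  then have "dist D x < r" using nonneg_imp e by (simp add: Deq dist_norm)
  moreover have "t \<bullet> D - L t \<le> g"
  proof -
    have "t \<bullet> D - L t = (t \<bullet> x - L t) - e * (t \<bullet> t)" by (simp add: Deq inner_diff_right)
    moreover have "0 \<le> e * (t \<bullet> t)" using e by simp
    ultimately show ?thesis using gt[of t] by linarith
  qed
  ultimately show ?thesis using D unfolding g by (intro exI conjI) auto
qed

text \<open>Undoing the tilt: on the ball the density \<open>exp (t \<bullet> Z n)\<close> is at
  most \<open>exp (n (t \<bullet> D + norm t * r))\<close>.\<close>

lemma prob_ball_ge:
  assumes "regular n" "0 < r"
  shows "exp (- (real n * (t \<bullet> D + norm t * r))) * tilted_mass n t (ball D r)
    \<le> prob {\<omega> \<in> space P. Z n \<omega> /\<^sub>R real n \<in> ball D r}"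
proof -
  have n: "0 < real n" using assms by (simp add: regular_def)
  have "exp (- (real n * (t \<bullet> D + norm t * r))) * tilted_mass n t (ball D r)
     = expectation (\<lambda>\<omega>. exp (- (real n * (t \<bullet> D + norm t * r))) *
         (exp (t \<bullet> Z n \<omega>) * indicator (ball D r) (Z n \<omega> /\<^sub>R real n)))"
    by (simp add: tilted_mass_def)
  also have "\<dots> \<le> expectation (\<lambda>\<omega>. exp (0 \<bullet> Z n \<omega>) * indicator (ball D r) (Z n \<omega> /\<^sub>R real n))"
  proof (intro integral_mono integrable_mult_right integrable_tilted assms)
    fix \<omega>
    let ?z = "Z n \<omega> /\<^sub>R real n"
    have "t \<bullet> Z n \<omega> \<le> real n * (t \<bullet> D + norm t * r)" if "?z \<in> ball D r"
    proof -
      have "t \<bullet> (?z - D) \<le> norm t * norm (?z - D)" by (rule norm_cauchy_schwarz)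
      also have "\<dots> \<le> norm t * r"
        using that by (intro mult_left_mono) (auto simp: dist_norm norm_minus_commute)
      finally have "t \<bullet> ?z \<le> t \<bullet> D + norm t * r" by (simp add: inner_diff_right)
      moreover have "t \<bullet> Z n \<omega> = real n * (t \<bullet> ?z)" using n by simp
      ultimately show ?thesis using n by (metis mult_left_mono less_imp_le)
    qed
    then show "exp (- (real n * (t \<bullet> D + norm t * r))) * (exp (t \<bullet> Z n \<omega>) * indicator (ball D r) ?z)
        \<le> exp (0 \<bullet> Z n \<omega>) * indicator (ball D r) ?z"
      by (auto simp: indicator_def exp_add[symmetric] simp del: mem_ball)
  qed auto
  also have "\<dots> = prob {\<omega> \<in> space P. Z n \<omega> /\<^sub>R real n \<in> ball D r}"
    using tilted_mass_zero[OF assms(1), of "ball D r"] by (simp add: tilted_mass_def)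
  finally show ?thesis .
qed

text \<open>The law tilted by \<open>t\<close> eventually keeps half of its mass in a small ball
  around \<open>D\<close>. Removing the tilt there costs about \<open>t \<bullet> D\<close> per
  step, and the total mass returns \<open>L t\<close>.\<close>

lemma log_prob_ball_ge:
  assumes D: "GDERIV L t :> D" and r: "0 < r" and e: "0 < e"
  shows "\<forall>\<^sub>F n in sequentially. exp (real n * (- (t \<bullet> D - L t) - e))
    \<le> prob {\<omega> \<in> space P. Z n \<omega> /\<^sub>R real n \<in> ball D r}"
proof -
  \<comment> \<open>The loss \<open>e\<close> is split in three: the variation of the density over
    the ball of radius \<open>d\<close>, the factor \<open>1 / 2\<close>, and the error in
    \<open>mgf n t\<close>. The \<open>+ 1\<close> covers \<open>t = 0\<close>.\<close>
  define d where "d = min r (e / (3 * (norm t + 1)))"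
  have d: "0 < d" "d \<le> r" "norm t * d \<le> e / 3"
  proof -
    show "0 < d" "d \<le> r" using r e by (auto simp: d_def add_nonneg_pos)
    have "norm t * d \<le> (norm t + 1) * (e / (3 * (norm t + 1)))"
      using r e by (intro mult_mono) (auto simp: d_def)
    also have "\<dots> = e / 3" by (simp add: field_simps add_nonneg_eq_0_iff)
    finally show "norm t * d \<le> e / 3" .
  qed
  obtain c K where c: "0 < c" and K: "0 < K"
    and ev: "\<forall>\<^sub>F n in sequentially. tilted_mass n t (- ball D d) \<le> K * exp (- (real n * c)) * mgf n t"
    using decays_outside_ball[OF D d(1)] by (auto simp: decays_def)
  have "(\<lambda>n. K * exp (- c) ^ n) \<longlonglongrightarrow> K * 0"
    using c by (intro tendsto_intros LIMSEQ_realpow_zero) auto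
  then have ev2: "\<forall>\<^sub>F n in sequentially. K * exp (- c) ^ n < 1 / 2"
    by (rule order_tendstoD) simp
  have "(\<lambda>n. exp (- (e / 3)) ^ n) \<longlonglongrightarrow> 0"
    using e by (intro LIMSEQ_realpow_zero) auto
  then have ev3: "\<forall>\<^sub>F n in sequentially. exp (- (e / 3)) ^ n < 1 / 2"
    by (rule order_tendstoD) simp
  have e3: "0 < e / 3" using e by simp
  show ?thesis
    using ev ev2 ev3 eventually_regular eventually_mgf_bounds[OF e3, of t]
  proof eventually_elim
    case (elim n)
    have n: "0 < real n" using elim(4) by (simp add: regular_def)
    have mp: "0 < mgf n t" by (rule mgf_pos[OF elim(4)])
    have "K * exp (- (real n * c)) \<le> 1 / 2"
      using elim(2) by (simp add: exp_of_nat_mult[symmetric])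
    then have "K * exp (- (real n * c)) * mgf n t \<le> (1 / 2) * mgf n t"
      using mp by (intro mult_right_mono) auto
    then have "tilted_mass n t (- ball D d) \<le> (1 / 2) * mgf n t"
      using elim(1) by linarith
    then have half: "(1 / 2) * mgf n t \<le> tilted_mass n t (ball D d)"
      using tilted_mass_Compl[OF elim(4), of "ball D d" t] by simp
    have "real n * (- (t \<bullet> D - L t) - e)
        = - (real n * (t \<bullet> D + e / 3)) + (real n * (- (e / 3)) + real n * (L t - e / 3))"
      by (simp add: field_simps)
    then have "exp (real n * (- (t \<bullet> D - L t) - e))
        = exp (- (real n * (t \<bullet> D + e / 3))) * (exp (- (e / 3)) ^ n * exp (real n * (L t - e / 3)))"
      by (simp only: exp_add exp_of_nat_mult)
    also have "\<dots> \<le> exp (- (real n * (t \<bullet> D + norm t * d))) * ((1 / 2) * mgf n t)"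
      using elim(3,5) d(3) n by (intro mult_mono) auto
    also have "\<dots> \<le> exp (- (real n * (t \<bullet> D + norm t * d))) * tilted_mass n t (ball D d)"
      using half by (intro mult_left_mono) auto
    also have "\<dots> \<le> prob {\<omega> \<in> space P. Z n \<omega> /\<^sub>R real n \<in> ball D d}"
      by (rule prob_ball_ge[OF elim(4) d(1)])
    also have "\<dots> \<le> prob {\<omega> \<in> space P. Z n \<omega> /\<^sub>R real n \<in> ball D r}"
      using tilted_mass_mono[OF elim(4), of "ball D d" "ball D r" 0] subset_ball[OF d(2), of D]
        tilted_mass_zero[OF elim(4), of "ball D d"] tilted_mass_zero[OF elim(4), of "ball D r"]
      by simp
    finally show ?case .
  qed
qed

text \<open>It suffices to treat each \<open>x\<close> in \<open>U\<close> of finite rate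
  \<open>g\<close>: a ball around a nearby gradient lies in \<open>U\<close>, and its cost
  \<open>t \<bullet> D - L t\<close> is at most \<open>g\<close>.\<close>

lemma LDP_lower_bound:
  assumes diff: "\<And>t. \<exists>D. GDERIV L t :> D" and U: "open U"
  shows "- (INF x\<in>U. rate x)
    \<le> liminf (\<lambda>n. log_prob (prob {\<omega> \<in> space P. Z n \<omega> /\<^sub>R real n \<in> U}) / ereal (real n))"
proof -
  let ?p = "\<lambda>n. prob {\<omega> \<in> space P. Z n \<omega> /\<^sub>R real n \<in> U}"
  let ?l = "liminf (\<lambda>n. log_prob (?p n) / ereal (real n))"
  have "- rate x \<le> ?l" if x: "x \<in> U" for x
  proof (cases "rate x = \<infinity>")
    case False
    then have fin: "rate x < \<infinity>" by simp
    obtain g where g: "rate x = ereal g"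
      using fin rate_nonneg[of x] by (cases "rate x") auto
    obtain r where r: "0 < r" "ball x r \<subseteq> U" using U x by (meson openE)
    obtain t D where tD: "GDERIV L t :> D" "dist D x < r / 2" "t \<bullet> D - L t \<le> g"
      using exists_tilt_near[OF diff fin, of "r / 2"] r(1) g by auto
    have sub: "ball D (r / 2) \<subseteq> U"
    proof
      fix z assume "z \<in> ball D (r / 2)"
      then have "dist x z < r" using tD(2) dist_triangle[of x z D] by (simp add: dist_commute)
      then show "z \<in> U" using r(2) by auto
    qed
    have "ereal (- g) \<le> ?l"
    proof (rule ereal_le_epsilon2)
      fix e :: real assume e: "0 < e"
      have "\<forall>\<^sub>F n in sequentially. ereal (- g - e) \<le> log_prob (?p n) / ereal (real n)"
        using log_prob_ball_ge[OF tD(1) half_gt_zero[OF r(1)] e] eventually_regular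
      proof eventually_elim
        case (elim n)
        have n: "0 < real n" using elim(2) by (simp add: regular_def)
        have "exp (real n * (- g - e)) \<le> exp (real n * (- (t \<bullet> D - L t) - e))"
          using n tD(3) by simp
        also have "\<dots> \<le> prob {\<omega> \<in> space P. Z n \<omega> /\<^sub>R real n \<in> ball D (r / 2)}"
          by (rule elim(1))
        also have "\<dots> \<le> ?p n"
          using tilted_mass_mono[OF elim(2), of "ball D (r / 2)" U 0] sub U
            tilted_mass_zero[OF elim(2), of U] tilted_mass_zero[OF elim(2), of "ball D (r / 2)"]
          by simp
        finally have le: "exp (real n * (- g - e)) \<le> ?p n" .
        then have pos: "0 < ?p n" using exp_gt_zero less_le_trans by blast
        then have "real n * (- g - e) \<le> ln (?p n)" using le by (simp add: ln_ge_iff)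
        then have "- g - e \<le> ln (?p n) / real n" using n by (simp add: field_simps)
        then show ?case using pos n by (simp add: log_prob_def)
      qed
      then have "ereal (- g - e) \<le> ?l" by (intro Liminf_bounded)
      then show "ereal (- g) \<le> ?l + ereal e" by (cases ?l) (auto simp: )
    qed
    then show ?thesis by (simp add: g)
  qed simp
  then have "(SUP x\<in>U. - rate x) \<le> ?l" by (intro SUP_least)
  then show ?thesis by (simp add: ereal_SUP_uminus_eq)
qed

text \<open>As \<open>L\<close> is finite everywhere, its domain has no boundary on which steepness
  would have to be checked, and differentiability amounts to essential smoothness.\<close>

theorem gaertner_ellis:
  assumes diff: "\<And>t. \<exists>D. GDERIV L t :> D"
  shows "satisfies_LDP P (\<lambda>n \<omega>. Z n \<omega> /\<^sub>R real n) real rate"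
  unfolding satisfies_LDP_def
proof (intro conjI allI impI)
  show "rate_function rate"
    using good_rate_function_rate by (simp add: good_rate_function_def)
qed (use diff in \<open>auto intro: filterlim_real_sequentially LDP_upper_bound LDP_lower_bound\<close>)

end

section \<open>Perron-Frobenius eigenvalues of primitive matrices\<close>

lemma matrix_vector_component: "(T *v x) $ i = (\<Sum>j\<in>UNIV. T $ i $ j * x $ j)"
  by (simp add: matrix_vector_mult_def)

lemma mat_pow_add: "mat_pow T (a + b) = mat_pow T a ** mat_pow T b"
  by (induction a) (simp_all add: matrix_mul_assoc)

lemma mat_pow_commute: "mat_pow T n ** T = T ** mat_pow T n"
  using mat_pow_add[of T n 1] mat_pow_add[of T 1 n] by simp

lemma transpose_mat_pow: "transpose (mat_pow T n) = mat_pow (transpose T) n"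
  by (induction n) (simp_all add: matrix_transpose_mul transpose_mat mat_pow_commute)

lemma mat_pow_eigenvector:
  assumes "T *v u = r *\<^sub>R u"
  shows "mat_pow T n *v u = r ^ n *\<^sub>R u"
proof (induction n)
  case (Suc n)
  have "mat_pow T (Suc n) *v u = T *v (r ^ n *\<^sub>R u)"
    using Suc by (simp add: matrix_vector_mul_assoc[symmetric])
  also have "\<dots> = r ^ n *\<^sub>R (T *v u)"
    by (simp add: linear_cmul)
  finally show ?case using assms by simp
qed simp

lemma nonneg_vec_mult: "nonneg_mat T \<Longrightarrow> nonneg_vec x \<Longrightarrow> nonneg_vec (T *v x)"
  by (auto simp: nonneg_mat_def nonneg_vec_def matrix_vector_component intro!: sum_nonneg)

lemma nonneg_mat_mult: "nonneg_mat S \<Longrightarrow> nonneg_mat T \<Longrightarrow> nonneg_mat (S ** T)"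
  by (auto simp: nonneg_mat_def matrix_matrix_mult_def intro!: sum_nonneg)

lemma nonneg_mat_pow: "nonneg_mat T \<Longrightarrow> nonneg_mat (mat_pow T n)"
proof (induction n)
  case 0
  show ?case by (simp add: nonneg_mat_def mat_def)
qed (simp add: nonneg_mat_mult)

lemma inner_nonneg_vec: "nonneg_vec x \<Longrightarrow> nonneg_vec z \<Longrightarrow> 0 \<le> x \<bullet> z"
  by (auto simp: nonneg_vec_def inner_vec_def intro!: sum_nonneg)

lemma inner_pos_vec:
  assumes x: "nonneg_vec x" "x \<noteq> 0" and z: "\<And>i. 0 < z $ i"
  shows "0 < x \<bullet> z"
proof -
  obtain i where i: "x $ i \<noteq> 0" using x(2) by (auto simp: vec_eq_iff)
  have "0 \<le> x $ j" for j using x(1) by (simp add: nonneg_vec_def)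
  then have "0 < x $ i" using i by (simp add: order_less_le)
  then show ?thesis unfolding inner_vec_def
    by (intro sum_pos2[of UNIV i]) (use \<open>\<And>j. 0 \<le> x $ j\<close> less_imp_le[OF z] z in auto)
qed

lemma pos_mat_vec:
  assumes "\<And>i j. 0 < S $ i $ j" "nonneg_vec x" "x \<noteq> 0"
  shows "0 < (S *v x) $ i"
  using inner_pos_vec[OF assms(2,3), of "S $ i"] assms(1)
  by (simp add: matrix_vector_mul_component inner_commute)

section \<open>Existence of a positive eigenvector\<close>

definition prob_simplex :: "(real^'m) set" where
  "prob_simplex = {x. nonneg_vec x \<and> (\<Sum>i\<in>UNIV. x $ i) = 1}"

lemma prob_simplex_nonzero: "x \<in> prob_simplex \<Longrightarrow> x \<noteq> 0"
  by (auto simp: prob_simplex_def)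

lemma compact_prob_simplex: "compact (prob_simplex :: (real^'m) set)"
proof -
  have "closed (prob_simplex :: (real^'m) set)"
    unfolding prob_simplex_def nonneg_vec_def
    by (intro closed_Collect_conj closed_Collect_all closed_Collect_le closed_Collect_eq continuous_intros)
  moreover have "norm x \<le> 1" if "x \<in> prob_simplex" for x :: "real^'m"
  proof -
    have "norm x \<le> (\<Sum>i\<in>UNIV. \<bar>x $ i\<bar>)" by (rule norm_le_l1_cart)
    also have "\<dots> = 1" using that by (simp add: prob_simplex_def nonneg_vec_def)
    finally show ?thesis .
  qed
  ultimately show ?thesis by (auto simp: compact_eq_bounded_closed bounded_iff)
qed

lemma convex_prob_simplex: "convex prob_simplex"
  unfolding convex_def
  by (auto simp: prob_simplex_def nonneg_vec_def sum.distrib sum_distrib_left[symmetric])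

lemma prob_simplex_nonempty: "(prob_simplex :: (real^'m) set) \<noteq> {}"
proof -
  have "(\<chi> i. 1 / real CARD('m)) \<in> (prob_simplex :: (real^'m) set)"
    by (simp add: prob_simplex_def nonneg_vec_def)
  then show ?thesis by blast
qed

lemma primitive_matE:
  assumes "primitive_mat T"
  obtains k where "1 \<le> k" "\<And>i j. 0 < mat_pow T k $ i $ j"
  using assms by (auto simp: primitive_mat_def)

text \<open>The positive power has exponent \<open>k \<ge> 1\<close> and so factors through
  \<open>T\<close>. This makes the rescaling in the fixed point argument well defined.\<close>

lemma primitive_mat_vec_nonzero:
  assumes T: "primitive_mat T" and x: "nonneg_vec x" "x \<noteq> 0"
  shows "T *v x \<noteq> 0"
proof
  assume 0: "T *v x = 0"
  obtain k where k: "1 \<le> k" "\<And>i j. 0 < mat_pow T k $ i $ j" by (rule primitive_matE[OF T]) (rule that)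
  have "mat_pow T k = mat_pow T (k - 1) ** T"
    using k(1) mat_pow_add[of T "k - 1" 1] by simp
  then have "mat_pow T k *v x = 0" using 0 by (simp add: matrix_vector_mul_assoc[symmetric])
  moreover have "0 < (mat_pow T k *v x) $ i" for i by (rule pos_mat_vec[OF k(2) x])
  ultimately show False by simp
qed

text \<open>\<open>T\<close> followed by rescaling to coordinate sum one maps the simplex
  continuously to itself. A Brouwer fixed point is an eigenvector whose eigenvalue is the scaling
  factor.\<close>

lemma primitive_eigenvector_exists:
  assumes T: "primitive_mat (T :: real^'m^'m)"
  shows "\<exists>u\<in>prob_simplex. \<exists>r. T *v u = r *\<^sub>R u"
proof -
  define s where "s x = (\<Sum>i\<in>UNIV. (T *v x) $ i)" for x
  have nn: "nonneg_vec (T *v x)" if "x \<in> prob_simplex" for x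
    using T that by (simp add: nonneg_vec_mult prob_simplex_def primitive_mat_def)
  have s_pos: "0 < s x" if x: "x \<in> prob_simplex" for x
  proof -
    have "T *v x \<noteq> 0"
      using primitive_mat_vec_nonzero[OF T _ prob_simplex_nonzero[OF x]] x by (simp add: prob_simplex_def)
    then obtain i where "(T *v x) $ i \<noteq> 0" by (auto simp: vec_eq_iff)
    then show ?thesis unfolding s_def
      by (intro sum_pos2[of UNIV i]) (use nn[OF x] in \<open>auto simp: nonneg_vec_def less_le\<close>)
  qed
  define f where "f x = (1 / s x) *\<^sub>R (T *v x)" for x
  have "continuous_on prob_simplex f"
    unfolding f_def s_def
    by (intro continuous_intros linear_continuous_on matrix_vector_mul_bounded_linear)
       (use s_pos in \<open>force simp: s_def\<close>)
  moreover have "f \<in> prob_simplex \<rightarrow> prob_simplex"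
  proof
    fix x :: "real^'m" assume x: "x \<in> prob_simplex"
    show "f x \<in> prob_simplex"
      using nn[OF x] s_pos[OF x]
      by (auto simp: f_def prob_simplex_def nonneg_vec_def sum_divide_distrib[symmetric] s_def[symmetric])
  qed
  ultimately obtain u where u: "u \<in> prob_simplex" "f u = u"
    using brouwer[OF compact_prob_simplex convex_prob_simplex prob_simplex_nonempty] by blast
  have "T *v u = s u *\<^sub>R f u" using s_pos[OF u(1)] by (simp add: f_def)
  then show ?thesis using u by auto
qed

text \<open>The positive power of \<open>T\<close> sends \<open>x\<close> both to a positive vector
  and to \<open>r ^ k\<close> times \<open>x\<close>, so no coordinate of \<open>x\<close> can
  vanish.\<close>

lemma primitive_eigenvector_pos:
  assumes T: "primitive_mat T" and x: "nonneg_vec x" "x \<noteq> 0" and eig: "T *v x = r *\<^sub>R x"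
  shows "0 < x $ i" "0 < r"
proof -
  obtain k where k: "1 \<le> k" "\<And>i j. 0 < mat_pow T k $ i $ j" by (rule primitive_matE[OF T]) (rule that)
  have pos: "0 < r ^ k * x $ i" for i
    using pos_mat_vec[OF k(2) x, of i] by (simp add: mat_pow_eigenvector[OF eig])
  have nn: "0 \<le> x $ i" for i using x by (simp add: nonneg_vec_def)
  show xp: "0 < x $ i" for i
  proof -
    have "x $ i \<noteq> 0" using pos[of i] by auto
    then show ?thesis using nn[of i] by linarith
  qed
  have "nonneg_vec (T *v x)" using T x by (simp add: nonneg_vec_mult primitive_mat_def)
  then have "0 \<le> r * x $ i" by (simp add: eig nonneg_vec_def)
  then have "0 \<le> r" using xp[of i] by (simp add: zero_le_mult_iff)
  moreover have "r \<noteq> 0"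
  proof
    assume "r = 0"
    then show False using pos[of i] k(1) by (simp add: power_0_left)
  qed
  ultimately show "0 < r" by simp
qed

section \<open>Dominance and uniqueness of the positive eigenvalue\<close>

lemma complex_mat_pow_eigenvector:
  assumes "\<And>i. (\<Sum>j\<in>UNIV. complex_of_real (T $ i $ j) * v $ j) = z * v $ i"
  shows "(\<Sum>j\<in>UNIV. complex_of_real (mat_pow T n $ i $ j) * v $ j) = z ^ n * v $ i"
proof (induction n arbitrary: i)
  case 0
  show ?case by (simp add: mat_def if_distrib if_distribR cong: if_cong)
next
  case (Suc n)
  have "(\<Sum>j\<in>UNIV. complex_of_real (mat_pow T (Suc n) $ i $ j) * v $ j)
      = (\<Sum>j\<in>UNIV. \<Sum>l\<in>UNIV. complex_of_real (T $ i $ l) * (complex_of_real (mat_pow T n $ l $ j) * v $ j))"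
    by (simp add: matrix_matrix_mult_def sum_distrib_right mult.assoc)
  also have "\<dots> = (\<Sum>l\<in>UNIV. complex_of_real (T $ i $ l) * (\<Sum>j\<in>UNIV. complex_of_real (mat_pow T n $ l $ j) * v $ j))"
    by (subst sum.swap) (simp add: sum_distrib_left)
  also have "\<dots> = z ^ n * (\<Sum>l\<in>UNIV. complex_of_real (T $ i $ l) * v $ l)"
    by (simp only: Suc) (simp add: sum_distrib_left mult.left_commute)
  finally show ?case by (simp add: assms)
qed

text \<open>The ratios \<open>v $ j / u $ j\<close> have a weighted mean \<open>p\<close>, with positive weights, whose modulus is
  at least the largest of theirs. So their variance about \<open>p\<close> vanishes and they all equal \<open>p\<close>.\<close>

lemma primitive_dominant_eigenvalue:
  fixes v :: "complex^'m"
  assumes T: "primitive_mat T" and u: "\<And>i. 0 < u $ i" and eig: "T *v u = r *\<^sub>R u"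
    and v: "v \<noteq> 0" and eigv: "map_matrix complex_of_real T *v v = z *s v" and z: "r \<le> cmod z"
  shows "z = complex_of_real r \<and> (\<exists>p. \<forall>i. v $ i = p * complex_of_real (u $ i))"
proof -
  have un: "nonneg_vec u" "u \<noteq> 0"
    using less_imp_le[OF u] less_imp_neq[OF u] by (auto simp: nonneg_vec_def vec_eq_iff)
  have r: "0 < r" by (rule primitive_eigenvector_pos(2)[OF T un eig])
  obtain k where k: "\<And>i j. 0 < mat_pow T k $ i $ j" by (rule primitive_matE[OF T]) (rule that)
  define S where "S = mat_pow T k"
  have eigv': "(\<Sum>j\<in>UNIV. complex_of_real (T $ i $ j) * v $ j) = z * v $ i" for i
    using arg_cong[OF eigv, of "\<lambda>x. x $ i"] by (simp add: matrix_vector_component)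
  have Su: "(\<Sum>j\<in>UNIV. S $ i $ j * u $ j) = r ^ k * u $ i" for i
    using arg_cong[OF mat_pow_eigenvector[OF eig, of k], of "\<lambda>x. x $ i"]
    by (simp add: S_def matrix_vector_component)
  have Sv: "(\<Sum>j\<in>UNIV. complex_of_real (S $ i $ j) * v $ j) = z ^ k * v $ i" for i
    unfolding S_def by (rule complex_mat_pow_eigenvector[OF eigv'])
  define x where "x j = v $ j / complex_of_real (u $ j)" for j
  have vx: "v $ j = x j * complex_of_real (u $ j)" for j
    using u[of j] by (simp add: x_def)
  obtain i where i: "\<And>j. cmod (x j) \<le> cmod (x i)"
  proof -
    let ?X = "range (\<lambda>j. cmod (x j))"
    have "Max ?X \<in> ?X" by (rule Max_in) auto
    then obtain i where "Max ?X = cmod (x i)" by blast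
    moreover have "cmod (x j) \<le> Max ?X" for j by (rule Max_ge) auto
    ultimately show ?thesis using that[of i] by simp
  qed
  \<comment> \<open>Weights from row \<open>i\<close> of \<open>S\<close>, where \<open>i\<close>
    has the ratio of largest modulus. They sum to one because \<open>u\<close> is an eigenvector of
    \<open>S\<close>.\<close>
  define q where "q j = S $ i $ j * u $ j / (r ^ k * u $ i)" for j
  have q_pos: "0 < q j" for j using k u r by (simp add: q_def S_def)
  have q_sum: "(\<Sum>j\<in>UNIV. q j) = 1"
    using r u[of i] by (simp add: q_def sum_divide_distrib[symmetric] Su)
  define p where "p = (\<Sum>j\<in>UNIV. q j *\<^sub>R x j)"
  \<comment> \<open>Row \<open>i\<close> of \<open>S v = z ^ k v\<close>, divided by that of
    \<open>S u = r ^ k u\<close>. Then \<open>r \<le> cmod z\<close> gives \<open>p\<close> at least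
    the modulus of \<open>x i\<close>.\<close>
  have "p = z ^ k * x i / complex_of_real r ^ k"
  proof -
    have "q j *\<^sub>R x j = complex_of_real (S $ i $ j) * v $ j / complex_of_real (r ^ k * u $ i)" for j
      using u[of j] by (simp add: q_def x_def scaleR_conv_of_real)
    then have "p = z ^ k * v $ i / complex_of_real (r ^ k * u $ i)"
      by (simp add: p_def sum_divide_distrib[symmetric] Sv)
    then show ?thesis by (simp add: x_def)
  qed
  then have "cmod p = (cmod z / r) ^ k * cmod (x i)"
    using r by (simp add: norm_mult norm_divide norm_power power_divide)
  moreover have "1 \<le> (cmod z / r) ^ k" using r z by (intro one_le_power) simp
  ultimately have p_ge: "cmod (x i) \<le> cmod p"
    using mult_right_mono[of 1 "(cmod z / r) ^ k" "cmod (x i)"] by simp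
  \<comment> \<open>The variance as mean square minus squared mean, with \<open>\<bullet>\<close>
    the real inner product on the complex plane.\<close>
  have "(\<Sum>j\<in>UNIV. q j * (norm (x j - p))\<^sup>2)
      = (\<Sum>j\<in>UNIV. q j * (norm (x j))\<^sup>2 - 2 * (p \<bullet> (q j *\<^sub>R x j)) + q j * (norm p)\<^sup>2)"
    by (intro sum.cong) (auto simp: power2_norm_eq_inner algebra_simps inner_commute)
  also have "\<dots> = (\<Sum>j\<in>UNIV. q j * (norm (x j))\<^sup>2) - 2 * (p \<bullet> p) + (norm p)\<^sup>2"
    by (simp add: sum.distrib sum_subtractf sum_distrib_left[symmetric] inner_sum_right[symmetric]
        sum_distrib_right[symmetric] q_sum p_def[symmetric] del: inner_scaleR_right)
  also have "\<dots> = (\<Sum>j\<in>UNIV. q j * (norm (x j))\<^sup>2) - (norm p)\<^sup>2"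
    by (simp add: power2_norm_eq_inner)
  also have "\<dots> \<le> (\<Sum>j\<in>UNIV. q j * (norm p)\<^sup>2) - (norm p)\<^sup>2"
  proof -
    have "q j * (norm (x j))\<^sup>2 \<le> q j * (norm p)\<^sup>2" for j
      using q_pos[of j] order_trans[OF i p_ge, of j] by (intro mult_left_mono power_mono) auto
    then show ?thesis by (intro diff_right_mono sum_mono)
  qed
  also have "\<dots> = 0" by (simp add: sum_distrib_right[symmetric] q_sum)
  finally have "(\<Sum>j\<in>UNIV. q j * (norm (x j - p))\<^sup>2) \<le> 0" .
  moreover have "0 \<le> q j * (norm (x j - p))\<^sup>2" for j using q_pos[of j] by simp
  ultimately have q0: "q j * (norm (x j - p))\<^sup>2 = 0" for j
    using sum_nonneg_eq_0_iff[of UNIV "\<lambda>j. q j * (norm (x j - p))\<^sup>2"]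
    by (simp add: antisym sum_nonneg)
  have xp: "x j = p" for j using q0[of j] q_pos[of j] by auto
  then have vp: "v $ j = p * complex_of_real (u $ j)" for j using vx by simp
  have "p \<noteq> 0" using v vp by (auto simp: vec_eq_iff)
  have "z * v $ i = (\<Sum>j\<in>UNIV. complex_of_real (T $ i $ j) * v $ j)" using eigv' by simp
  also have "\<dots> = p * complex_of_real (\<Sum>j\<in>UNIV. T $ i $ j * u $ j)"
    by (simp add: vp sum_distrib_left algebra_simps)
  also have "(\<Sum>j\<in>UNIV. T $ i $ j * u $ j) = r * u $ i"
    using arg_cong[OF eig, of "\<lambda>x. x $ i"] by (simp add: matrix_vector_component)
  finally have "z * v $ i = complex_of_real r * v $ i" by (simp add: vp)
  then have "z = complex_of_real r" using vp[of i] \<open>p \<noteq> 0\<close> u[of i] by simp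
  then show ?thesis using vp by blast
qed

lemma complexify_eigenvector:
  assumes "T *v u = r *\<^sub>R u"
  shows "map_matrix complex_of_real T *v (\<chi> i. complex_of_real (u $ i)) = complex_of_real r *s (\<chi> i. complex_of_real (u $ i))"
  using arg_cong[OF assms, of "\<lambda>x. x $ i" for i]
  by (simp add: vec_eq_iff matrix_vector_component flip: of_real_mult of_real_sum)

text \<open>A nonnegative eigenvector is automatically positive, so its eigenvalue dominates all
  others. Two distinct dominant eigenvalues would each be strictly smaller in modulus than the
  other.\<close>

lemma pf_eigenvalue_eqI:
  assumes T: "primitive_mat T" and u: "nonneg_vec u" "u \<noteq> 0" and eig: "T *v u = r *\<^sub>R u"
  shows "pf_eigenvalue T = r"
proof -
  let ?T = "map_matrix complex_of_real T"
  note pos = primitive_eigenvector_pos[OF T u eig]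
  have ev: "is_eigenvalue ?T (complex_of_real r)"
    unfolding is_eigenvalue_def
    by (intro exI[of _ "\<chi> i. complex_of_real (u $ i)"] conjI complexify_eigenvector eig)
       (use u(2) in \<open>auto simp: vec_eq_iff\<close>)
  have dom: "cmod z < cmod (complex_of_real r)" if "is_eigenvalue ?T z" "z \<noteq> complex_of_real r" for z
    using that primitive_dominant_eigenvalue[OF T pos(1) eig] pos(2)
    by (force simp: is_eigenvalue_def not_le)
  show ?thesis unfolding pf_eigenvalue_def
  proof (rule the_equality)
    fix r' assume r': "is_eigenvalue ?T (complex_of_real r') \<and>
      (\<forall>z. is_eigenvalue ?T z \<and> z \<noteq> complex_of_real r' \<longrightarrow> cmod z < cmod (complex_of_real r'))"
    show "r' = r"
    proof (rule ccontr)
      assume "r' \<noteq> r"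
      then show False using r' ev dom[of "complex_of_real r'"] by (metis of_real_eq_iff less_asym)
    qed
  qed (use ev dom in auto)
qed

text \<open>Both eigenvalues are the Perron-Frobenius eigenvalue, so dominance makes
  \<open>x\<close> a multiple of \<open>u\<close>; equal coordinate sums force the factor to be
  \<open>1\<close>.\<close>

lemma primitive_simplex_eigenvector_unique:
  assumes T: "primitive_mat T" and u: "u \<in> prob_simplex" and eigu: "T *v u = r *\<^sub>R u"
    and x: "x \<in> prob_simplex" and eigx: "T *v x = r' *\<^sub>R x"
  shows "x = u"
proof -
  have un: "nonneg_vec u" "u \<noteq> 0" and xn: "nonneg_vec x" "x \<noteq> 0"
    using u x prob_simplex_nonzero by (auto simp: prob_simplex_def)
  have "r = r'"
    using pf_eigenvalue_eqI[OF T un eigu] pf_eigenvalue_eqI[OF T xn eigx] by simp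
  let ?x = "\<chi> i. complex_of_real (x $ i)"
  have "?x \<noteq> 0" using xn by (auto simp: vec_eq_iff)
  then obtain p where "\<And>i. ?x $ i = p * complex_of_real (u $ i)"
    using primitive_dominant_eigenvalue[OF T primitive_eigenvector_pos(1)[OF T un eigu] eigu _
        complexify_eigenvector[OF eigx]] \<open>r = r'\<close> by fastforce
  then have p: "complex_of_real (x $ i) = p * complex_of_real (u $ i)" for i by simp
  have "complex_of_real (\<Sum>i\<in>UNIV. x $ i) = p * complex_of_real (\<Sum>i\<in>UNIV. u $ i)"
    by (simp add: p sum_distrib_left)
  moreover have "(\<Sum>i\<in>UNIV. x $ i) = 1" "(\<Sum>i\<in>UNIV. u $ i) = 1"
    using u x by (auto simp: prob_simplex_def)
  ultimately have "p = 1" by (simp only: of_real_1 mult_1_right)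
  then show ?thesis using p by (simp add: vec_eq_iff)
qed

section \<open>Right and left Perron vectors and their continuity\<close>

text \<open>For primitive \<open>T\<close> the choice is unique. Normalising in the compact simplex
  prepares the closed graph argument for continuity.\<close>

definition perron_vec :: "real^'m^'m \<Rightarrow> real^'m" where
  "perron_vec T = (SOME u. u \<in> prob_simplex \<and> (\<exists>r. T *v u = r *\<^sub>R u))"

lemma perron_vec:
  assumes T: "primitive_mat T"
  shows perron_vec_simplex: "perron_vec T \<in> prob_simplex"
    and perron_vec_eigen: "T *v perron_vec T = pf_eigenvalue T *\<^sub>R perron_vec T"
    and perron_vec_pos: "0 < perron_vec T $ i"
    and pf_eigenvalue_pos: "0 < pf_eigenvalue T"
proof -
  obtain r where r: "perron_vec T \<in> prob_simplex" "T *v perron_vec T = r *\<^sub>R perron_vec T"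
    using someI_ex[of "\<lambda>u. u \<in> prob_simplex \<and> (\<exists>r. T *v u = r *\<^sub>R u)"] primitive_eigenvector_exists[OF T]
    unfolding perron_vec_def by blast
  have n: "nonneg_vec (perron_vec T)" "perron_vec T \<noteq> 0"
    using r(1) prob_simplex_nonzero by (auto simp: prob_simplex_def)
  have "pf_eigenvalue T = r" by (rule pf_eigenvalue_eqI[OF T n r(2)])
  then show "perron_vec T \<in> prob_simplex" "T *v perron_vec T = pf_eigenvalue T *\<^sub>R perron_vec T"
    "0 < perron_vec T $ i" "0 < pf_eigenvalue T"
    using r primitive_eigenvector_pos[OF T n r(2)] by auto
qed

lemma perron_vec_nonneg: "primitive_mat T \<Longrightarrow> nonneg_vec (perron_vec T)"
  using perron_vec_simplex by (auto simp: prob_simplex_def)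

lemma primitive_transpose: "primitive_mat T \<Longrightarrow> primitive_mat (transpose T)"
  unfolding primitive_mat_def nonneg_mat_def transpose_mat_pow[symmetric]
  by (auto simp: transpose_def)

lemma inner_matrix_vector: "w \<bullet> (T *v x) = (transpose T *v w) \<bullet> (x :: real^'m)"
  by (metis dot_lmul_matrix transpose_matrix_vector)

text \<open>The right Perron vector of the transpose. Its pairing with the right Perron vector of
  \<open>T\<close> is positive, so the two eigenvalues coincide.\<close>

lemma left_perron_vec:
  assumes T: "primitive_mat T"
  obtains w where "\<And>i. 0 < w $ i" "\<And>x. w \<bullet> (T *v x) = pf_eigenvalue T * (w \<bullet> x)"
proof -
  define w where "w = perron_vec (transpose T)"
  note T' = primitive_transpose[OF T]
  have w: "w \<bullet> (T *v x) = pf_eigenvalue (transpose T) * (w \<bullet> x)" for x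
    unfolding inner_matrix_vector w_def by (simp only: perron_vec_eigen[OF T'] inner_scaleR_left)
  have wpos: "0 < w $ i" for i unfolding w_def by (rule perron_vec_pos[OF T'])
  have "0 < perron_vec T \<bullet> w"
    using perron_vec_simplex[OF T] prob_simplex_nonzero
    by (intro inner_pos_vec perron_vec_nonneg[OF T] wpos) auto
  then have "pf_eigenvalue (transpose T) = pf_eigenvalue T"
    using w[of "perron_vec T"] by (simp add: perron_vec_eigen[OF T] inner_commute)
  then show ?thesis using that[of w] wpos w by simp
qed

text \<open>A map into a compact set is continuous if its graph is closed. Uniqueness of the
  eigenvector describes the graph as the solution set of a continuous equation.\<close>

lemma continuous_on_perron_vec:
  fixes T :: "'a::euclidean_space \<Rightarrow> real^'m^'m"
  assumes prim: "\<And>t. primitive_mat (T t)" and cont: "continuous_on UNIV T"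
  shows "continuous_on UNIV (\<lambda>t. perron_vec (T t))"
proof (rule continuous_from_closed_graph[OF compact_prob_simplex])
  show "(\<lambda>t. perron_vec (T t)) \<in> UNIV \<rightarrow> prob_simplex"
    using perron_vec_simplex[OF prim] by auto
  \<comment> \<open>On the simplex the eigenvalue is the coordinate sum of the image, so the
    equation avoids \<open>pf_eigenvalue\<close>, whose continuity is not yet established.\<close>
  define s where "s t x = (\<Sum>i\<in>UNIV. (T t *v x) $ i)" for t x
  have "range (\<lambda>t. (t, perron_vec (T t)))
      = {tx. (\<forall>i. (T (fst tx) *v snd tx) $ i = s (fst tx) (snd tx) * snd tx $ i)} \<inter> UNIV \<times> prob_simplex"
    (is "?L = ?R")
  proof (intro equalityI subsetI)
    fix tx assume "tx \<in> ?L"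
    then obtain t where tx: "tx = (t, perron_vec (T t))" by auto
    have "s t (perron_vec (T t)) = pf_eigenvalue (T t)"
      using perron_vec_simplex[OF prim[of t]]
      by (simp add: s_def perron_vec_eigen[OF prim] sum_distrib_left[symmetric] prob_simplex_def)
    then show "tx \<in> ?R"
      using perron_vec_simplex[OF prim[of t]] by (simp add: tx perron_vec_eigen[OF prim])
  next
    fix tx assume tx: "tx \<in> ?R"
    then have "T (fst tx) *v snd tx = s (fst tx) (snd tx) *\<^sub>R snd tx" by (simp add: vec_eq_iff)
    then have "snd tx = perron_vec (T (fst tx))"
      by (rule primitive_simplex_eigenvector_unique[OF prim perron_vec_simplex[OF prim]
            perron_vec_eigen[OF prim], rotated]) (use tx in auto)
    then show "tx \<in> ?L" by (intro image_eqI[of _ _ "fst tx"]) (simp_all add: prod_eq_iff)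
  qed
  moreover have "closed \<dots>"
  proof -
    have [continuous_intros]: "continuous_on UNIV (\<lambda>tx::'a \<times> (real^'m). T (fst tx))"
      by (rule continuous_on_compose2[OF cont continuous_on_fst[OF continuous_on_id]]) simp
    show ?thesis
      unfolding s_def matrix_vector_component
      by (intro closed_Int closed_Times closed_UNIV compact_imp_closed compact_prob_simplex
          closed_Collect_all closed_Collect_eq continuous_intros)
  qed
  ultimately show "closed (range (\<lambda>t. (t, perron_vec (T t))))" by simp
qed

section \<open>Gradients\<close>

text \<open>Caratheodory's criterion in several variables: the remainder is
  \<open>(s - t) \<bullet> (K s - K t)\<close>, which Cauchy-Schwarz and continuity of
  \<open>K\<close> at \<open>t\<close> make negligible.\<close>

lemma GDERIV_caratheodory:
  fixes f :: "'a::euclidean_space \<Rightarrow> real"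
  assumes f: "\<And>s. f s - f t = (s - t) \<bullet> K s" and K: "isCont K t"
  shows "GDERIV f t :> K t"
  unfolding gderiv_def has_derivative_iff_norm
proof
  show "bounded_linear (\<lambda>h. h \<bullet> K t)" by (rule bounded_linear_inner_left)
  have "((\<lambda>s. norm (K s - K t)) \<longlongrightarrow> 0) (at t)"
    using K by (simp add: isCont_def LIM_zero tendsto_norm_zero)
  then show "((\<lambda>s. norm (f s - f t - (s - t) \<bullet> K t) / norm (s - t)) \<longlongrightarrow> 0) (at t)"
  proof (rule Lim_null_comparison[rotated], intro always_eventually allI)
    fix s
    have "norm (f s - f t - (s - t) \<bullet> K t) = \<bar>(s - t) \<bullet> (K s - K t)\<bar>"
      by (simp add: f inner_diff_right)
    also have "\<dots> \<le> norm (s - t) * norm (K s - K t)" by (rule Cauchy_Schwarz_ineq2)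
    finally show "norm (norm (f s - f t - (s - t) \<bullet> K t) / norm (s - t)) \<le> norm (K s - K t)"
      by (cases "s = t") (auto simp: field_simps)
  qed
qed

lemma GDERIV_unique:
  fixes f :: "'a::euclidean_space \<Rightarrow> real"
  assumes "GDERIV f t :> D" "GDERIV f t :> D'"
  shows "D = D'"
proof -
  have "(\<lambda>h. h \<bullet> D) = (\<lambda>h. h \<bullet> D')"
    using assms unfolding gderiv_def by (rule has_derivative_unique)
  then have "(D - D') \<bullet> D = (D - D') \<bullet> D'" by (rule fun_cong)
  then have "(D - D') \<bullet> (D - D') = 0" by (simp add: inner_diff_right)
  then show ?thesis by simp
qed

lemma gradient_eqI:
  fixes f :: "'a::euclidean_space \<Rightarrow> real"
  shows "GDERIV f t :> D \<Longrightarrow> gradient f t = D"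
  unfolding gradient_def by (rule the_equality) (auto intro: GDERIV_unique)

section \<open>Exponential growth of matrix powers\<close>

lemma vec_le_scaled_pos_vec:
  fixes v u :: "real^'m"
  assumes u: "\<And>i. 0 < u $ i"
  shows "\<exists>c>0. \<forall>i. v $ i \<le> c * u $ i"
proof (intro exI conjI allI)
  \<comment> \<open>The \<open>1\<close> keeps the constant positive even if
    \<open>v = 0\<close>.\<close>
  let ?c = "1 + (\<Sum>j\<in>UNIV. \<bar>v $ j / u $ j\<bar>)"
  show "0 < ?c" by (intro add_pos_nonneg sum_nonneg) auto
  fix i
  have "v $ i / u $ i \<le> \<bar>v $ i / u $ i\<bar>" by (rule abs_ge_self)
  also have "\<dots> \<le> (\<Sum>j\<in>UNIV. \<bar>v $ j / u $ j\<bar>)" by (rule member_le_sum) auto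
  finally show "v $ i \<le> ?c * u $ i" using u[of i] by (simp add: field_simps)
qed

lemma inner_mat_pow_mono:
  assumes T: "nonneg_mat T" and xi: "nonneg_vec \<xi>" and le: "\<And>i. v $ i \<le> v' $ i"
  shows "\<xi> \<bullet> (mat_pow T n *v v) \<le> \<xi> \<bullet> (mat_pow T n *v v')"
proof -
  have "nonneg_vec (v' - v)" using le by (simp add: nonneg_vec_def)
  then have "0 \<le> \<xi> \<bullet> (mat_pow T n *v (v' - v))"
    by (intro inner_nonneg_vec xi nonneg_vec_mult nonneg_mat_pow T)
  then show ?thesis by (simp add: matrix_vector_mult_diff_distrib inner_diff_right)
qed

text \<open>Comparison with the Perron vector, on which powers act by scalars. Above, a multiple of
  it dominates \<open>\<eta>\<close>. Below, \<open>k\<close> steps first make \<open>\<eta>\<close>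
  positive, at the price of the constant factor \<open>r ^ k\<close>.\<close>

lemma mat_pow_growth:
  assumes T: "primitive_mat T" and xi: "nonneg_vec \<xi>" "\<xi> \<noteq> 0" and eta: "nonneg_vec \<eta>" "\<eta> \<noteq> 0"
  shows "\<exists>a>0. \<exists>b>0. \<forall>\<^sub>F n in sequentially.
    a * pf_eigenvalue T ^ n \<le> \<xi> \<bullet> (mat_pow T n *v \<eta>) \<and> \<xi> \<bullet> (mat_pow T n *v \<eta>) \<le> b * pf_eigenvalue T ^ n"
proof -
  let ?u = "perron_vec T" and ?r = "pf_eigenvalue T"
  have Tn: "nonneg_mat T" using T by (simp add: primitive_mat_def)
  note r = pf_eigenvalue_pos[OF T] and u = perron_vec_pos[OF T]
  have xu: "0 < \<xi> \<bullet> ?u" by (rule inner_pos_vec[OF xi u])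
  have eig: "\<xi> \<bullet> (mat_pow T n *v (c *\<^sub>R ?u)) = c * (\<xi> \<bullet> ?u) * ?r ^ n" for n c
    by (simp add: linear_cmul mat_pow_eigenvector[OF perron_vec_eigen[OF T]])
  obtain b where b: "0 < b" "\<And>i. \<eta> $ i \<le> b * ?u $ i"
    using vec_le_scaled_pos_vec[OF u, of \<eta>] by blast
  have upper: "\<xi> \<bullet> (mat_pow T n *v \<eta>) \<le> b * (\<xi> \<bullet> ?u) * ?r ^ n" for n
    using inner_mat_pow_mono[OF Tn xi(1), of \<eta> "b *\<^sub>R ?u" n] b(2) by (simp add: eig)
  obtain k where k: "\<And>i j. 0 < mat_pow T k $ i $ j" by (rule primitive_matE[OF T]) (rule that)
  have "0 < (mat_pow T k *v \<eta>) $ i" for i by (rule pos_mat_vec[OF k eta])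
  then obtain c where c: "0 < c" "\<And>i. ?u $ i \<le> c * (mat_pow T k *v \<eta>) $ i"
    using vec_le_scaled_pos_vec[of "mat_pow T k *v \<eta>" ?u] by blast
  have lower: "(1 / c) * (\<xi> \<bullet> ?u) / ?r ^ k * ?r ^ n \<le> \<xi> \<bullet> (mat_pow T n *v \<eta>)" if "k \<le> n" for n
  proof -
    have "(1 / c) * (\<xi> \<bullet> ?u) / ?r ^ k * ?r ^ n = (1 / c) * (\<xi> \<bullet> ?u) * ?r ^ (n - k)"
      using r that by (simp add: power_diff)
    also have "\<dots> \<le> \<xi> \<bullet> (mat_pow T (n - k) *v (mat_pow T k *v \<eta>))"
      using inner_mat_pow_mono[OF Tn xi(1), of "(1 / c) *\<^sub>R ?u" "mat_pow T k *v \<eta>" "n - k"] c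
      by (simp add: eig field_simps)
    also have "\<dots> = \<xi> \<bullet> (mat_pow T n *v \<eta>)"
      using that mat_pow_add[of T "n - k" k] by (simp add: matrix_vector_mul_assoc)
    finally show ?thesis .
  qed
  show ?thesis
    by (intro exI[of _ "(1 / c) * (\<xi> \<bullet> ?u) / ?r ^ k"] exI[of _ "b * (\<xi> \<bullet> ?u)"] conjI
        eventually_mono[OF eventually_ge_at_top[of k]] lower upper)
       (use b c xu r in auto)
qed

lemma ln_mat_pow_tendsto:
  assumes T: "primitive_mat T" and xi: "nonneg_vec \<xi>" "\<xi> \<noteq> 0" and eta: "nonneg_vec \<eta>" "\<eta> \<noteq> 0"
  shows "(\<lambda>n. ln (\<xi> \<bullet> (mat_pow T n *v \<eta>)) / real n) \<longlonglongrightarrow> ln (pf_eigenvalue T)"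
    and "\<forall>\<^sub>F n in sequentially. 0 < \<xi> \<bullet> (mat_pow T n *v \<eta>)"
proof -
  let ?r = "pf_eigenvalue T" and ?s = "\<lambda>n. \<xi> \<bullet> (mat_pow T n *v \<eta>)"
  note r = pf_eigenvalue_pos[OF T]
  obtain a b where a: "0 < a" and b: "0 < b"
    and ev: "\<forall>\<^sub>F n in sequentially. a * ?r ^ n \<le> ?s n \<and> ?s n \<le> b * ?r ^ n"
    using mat_pow_growth[OF assms] by blast
  have ap: "0 < a * ?r ^ n" "0 < b * ?r ^ n" for n using a b r by auto
  show pos: "\<forall>\<^sub>F n in sequentially. 0 < ?s n"
    using ev by eventually_elim (use ap(1) in \<open>auto intro: less_le_trans\<close>)
  have *: "(\<lambda>n. ln c / real n + ln ?r) \<longlonglongrightarrow> ln ?r" for c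
    using tendsto_add[OF lim_const_over_n[of "ln c"] tendsto_const[of "ln ?r"]] by simp
  have **: "ln (c * ?r ^ n) / real n = ln c / real n + ln ?r" if "0 < c" "0 < n" for c n
    using that r by (simp add: ln_mult ln_realpow field_simps)
  show "(\<lambda>n. ln (?s n) / real n) \<longlonglongrightarrow> ln ?r"
  proof (rule tendsto_sandwich[OF _ _ *[of a] *[of b]])
    show "\<forall>\<^sub>F n in sequentially. ln a / real n + ln ?r \<le> ln (?s n) / real n"
      using ev pos eventually_gt_at_top[of 0]
    proof eventually_elim
      case (elim n)
      then have "ln (a * ?r ^ n) \<le> ln (?s n)" using ap(1)[of n] by simp
      then show ?case unfolding **[OF a elim(3), symmetric] by (rule divide_right_mono) simp
    qed
    show "\<forall>\<^sub>F n in sequentially. ln (?s n) / real n \<le> ln b / real n + ln ?r"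
      using ev pos eventually_gt_at_top[of 0]
    proof eventually_elim
      case (elim n)
      then have "ln (?s n) \<le> ln (b * ?r ^ n)" using ap(2)[of n] by simp
      then show ?case unfolding **[OF b elim(3), symmetric] by (rule divide_right_mono) simp
    qed
  qed
qed

section \<open>Symbol statistics\<close>

lemma nonneg_matD: "nonneg_mat T \<Longrightarrow> 0 \<le> T $ i $ j"
  by (simp add: nonneg_mat_def)

text \<open>Entrywise bounds survive products of nonnegative matrices. This carries positivity of a
  power of \<open>M\<close> over to \<open>M(t)\<close>.\<close>

lemma mat_pow_le_scaled:
  assumes S: "nonneg_mat S" and T: "nonneg_mat T" and c: "0 \<le> c"
    and le: "\<And>i j. c * S $ i $ j \<le> T $ i $ j"
  shows "c ^ n * mat_pow S n $ i $ j \<le> mat_pow T n $ i $ j"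
proof (induction n arbitrary: i j)
  case (Suc n)
  have "c ^ Suc n * mat_pow S (Suc n) $ i $ j
      = (\<Sum>k\<in>UNIV. (c * S $ i $ k) * (c ^ n * mat_pow S n $ k $ j))"
    by (simp add: matrix_matrix_mult_def sum_distrib_left mult_ac)
  also have "\<dots> \<le> (\<Sum>k\<in>UNIV. T $ i $ k * mat_pow T n $ k $ j)"
    using S T c le Suc nonneg_matD[OF nonneg_mat_pow[OF S, of n]]
    by (intro sum_mono mult_mono) (auto intro: nonneg_matD)
  finally show ?case by (simp add: matrix_matrix_mult_def)
qed simp

lemma tilted_matrix_component:
  "tilted_matrix A B t $ i $ j = (\<Sum>l\<in>UNIV. exp (t $ l) * A l $ i $ j) + B $ i $ j"
  by (simp add: tilted_matrix_def)

lemma tilted_matrix_vector: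
  "tilted_matrix A B t *v x = (\<Sum>l\<in>UNIV. exp (t $ l) *\<^sub>R (A l *v x)) + B *v x"
proof -
  have "(tilted_matrix A B t *v x) $ i = (\<Sum>l\<in>UNIV. \<Sum>j\<in>UNIV. exp (t $ l) * A l $ i $ j * x $ j) + (B *v x) $ i" for i
    by (subst sum.swap)
       (simp add: matrix_vector_component tilted_matrix_component distrib_right sum.distrib sum_distrib_right)
  then show ?thesis
    by (simp add: vec_eq_iff matrix_vector_component sum_distrib_left mult.assoc)
qed

lemma tilted_matrix_zero: "tilted_matrix A B 0 = sum_matrix A B"
  by (simp add: tilted_matrix_def sum_matrix_def)

lemma continuous_on_tilted_matrix:
  "continuous_on UNIV (tilted_matrix A B :: real^'l::finite \<Rightarrow> real^'m^'m)"
  unfolding tilted_matrix_def by (intro continuous_intros)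

lemma primitive_tilted_matrix:
  fixes A :: "'l::finite \<Rightarrow> real^'m^'m"
  assumes A: "\<And>l. nonneg_mat (A l)" and B: "nonneg_mat B" and prim: "primitive_mat (sum_matrix A B)"
  shows "primitive_mat (tilted_matrix A B t)"
proof -
  \<comment> \<open>The smallest coefficient in the tilted matrix, \<open>1\<close> being the
    coefficient of \<open>B\<close>.\<close>
  define c where "c = Min (insert 1 (range (\<lambda>l. exp (t $ l))))"
  have c: "0 < c" "c \<le> 1" "\<And>l. c \<le> exp (t $ l)"
    unfolding c_def by (auto simp del: Min_insert intro!: Min_le)
  have T: "nonneg_mat (tilted_matrix A B t)"
    using A B by (auto simp: nonneg_mat_def tilted_matrix_component intro!: add_nonneg_nonneg sum_nonneg)
  have S: "nonneg_mat (sum_matrix A B)" using prim by (simp add: primitive_mat_def)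
  have le: "c * sum_matrix A B $ i $ j \<le> tilted_matrix A B t $ i $ j" for i j
  proof -
    have "c * sum_matrix A B $ i $ j = (\<Sum>l\<in>UNIV. c * A l $ i $ j) + c * B $ i $ j"
      by (simp add: sum_matrix_def sum_distrib_left distrib_left)
    also have "\<dots> \<le> (\<Sum>l\<in>UNIV. exp (t $ l) * A l $ i $ j) + 1 * B $ i $ j"
      using c nonneg_matD[OF A] nonneg_matD[OF B] by (intro add_mono sum_mono mult_right_mono) auto
    finally show ?thesis by (simp add: tilted_matrix_component)
  qed
  obtain k where k: "1 \<le> k" "\<And>i j. 0 < mat_pow (sum_matrix A B) k $ i $ j"
    by (rule primitive_matE[OF prim]) (rule that)
  have "0 < mat_pow (tilted_matrix A B t) k $ i $ j" for i j
  proof -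
    have "0 < c ^ k * mat_pow (sum_matrix A B) k $ i $ j" using c(1) k(2) by simp
    also have "\<dots> \<le> mat_pow (tilted_matrix A B t) k $ i $ j"
      using c(1) by (intro mat_pow_le_scaled S T le) auto
    finally show ?thesis .
  qed
  then show ?thesis using T k(1) by (auto simp: primitive_mat_def)
qed

text \<open>With \<open>w\<close> a left eigenvector at \<open>t\<close> and \<open>u s\<close> a right one at \<open>s\<close>,
  \<open>(y s - y t) * (w \<bullet> u s) = w \<bullet> ((M s - M t) *v u s)\<close>: continuity of \<open>u\<close> gives differentiability of \<open>y\<close>.\<close>

lemma GDERIV_pf_eigenvalue_tilted:
  fixes A :: "'l::finite \<Rightarrow> real^'m^'m"
  assumes prim: "\<And>t. primitive_mat (tilted_matrix A B t)"
  shows "\<exists>D. GDERIV (\<lambda>t. pf_eigenvalue (tilted_matrix A B t)) t :> D"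
proof -
  let ?M = "tilted_matrix A B"
  define y where "y t = pf_eigenvalue (?M t)" for t
  define u where "u t = perron_vec (?M t)" for t
  obtain w where w: "\<And>i. 0 < w $ i" "\<And>x. w \<bullet> (?M t *v x) = pf_eigenvalue (?M t) * (w \<bullet> x)"
    by (rule left_perron_vec[OF prim[of t]]) (rule that)
  have cont_u: "continuous_on UNIV u"
    unfolding u_def by (rule continuous_on_perron_vec[OF prim continuous_on_tilted_matrix])
  have isCont_u: "isCont u t" using cont_u by (simp add: continuous_on_eq_continuous_at)
  have wu: "0 < w \<bullet> u s" for s
    using inner_pos_vec[OF perron_vec_nonneg[OF prim] prob_simplex_nonzero[OF perron_vec_simplex[OF prim]] w(1)]
    by (simp add: u_def inner_commute)
  \<comment> \<open>Caratheodory slopes of \<open>exp\<close>, defined also where the two arguments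
    coincide.\<close>
  obtain h where h: "\<And>z. exp z - exp (t $ l) = h l z * (z - t $ l)" "isCont (h l) (t $ l)" for l
  proof -
    have "\<exists>g. (\<forall>z. exp z - exp (t $ l) = g z * (z - t $ l)) \<and> isCont g (t $ l)" for l
      using DERIV_exp[of "t $ l"] unfolding CARAT_DERIV by blast
    then show ?thesis using that by metis
  qed
  \<comment> \<open>The identity is divided by \<open>w \<bullet> u s\<close>, which is positive,
    and each difference of exponentials is replaced by its slope times
    \<open>s $ l - t $ l\<close>.\<close>
  define K where "K s = (\<chi> l. h l (s $ l) * (w \<bullet> (A l *v u s)) / (w \<bullet> u s))" for s
  have diff: "y s - y t = (s - t) \<bullet> K s" for s
  proof -
    have Ms: "?M s *v x = ?M t *v x + (\<Sum>l\<in>UNIV. (exp (s $ l) - exp (t $ l)) *\<^sub>R (A l *v x))" for x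
      by (simp add: tilted_matrix_vector scaleR_left_diff_distrib sum_subtractf)
    have "y s * (w \<bullet> u s) = w \<bullet> (?M s *v u s)"
      by (simp add: u_def y_def perron_vec_eigen[OF prim])
    also have "\<dots> = y t * (w \<bullet> u s) + (\<Sum>l\<in>UNIV. (exp (s $ l) - exp (t $ l)) * (w \<bullet> (A l *v u s)))"
      by (simp add: Ms inner_add_right w(2) inner_sum_right y_def)
    finally have "y s - y t = (\<Sum>l\<in>UNIV. (exp (s $ l) - exp (t $ l)) * (w \<bullet> (A l *v u s))) / (w \<bullet> u s)"
      using wu[of s] by (simp add: field_simps)
    also have "\<dots> = (s - t) \<bullet> K s"
      by (simp add: inner_vec_def K_def h(1) sum_divide_distrib mult_ac)
    finally show ?thesis .
  qed
  have "isCont K t"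
  proof -
    have hs: "isCont (\<lambda>s. h l (s $ l)) t" for l
      by (rule isCont_o2[where f="\<lambda>s. s $ l" and g="h l"]) (intro continuous_intros h(2))+
    have "isCont (\<lambda>s. A l *v u s) t" for l
      by (rule isCont_o2[OF isCont_u]) (rule linear_continuous_at[OF matrix_vector_mul_bounded_linear])
    then have "isCont (\<lambda>s. h l (s $ l) * (w \<bullet> (A l *v u s)) / (w \<bullet> u s)) t" for l
      using wu[of t] by (intro continuous_intros hs isCont_u) auto
    then show ?thesis unfolding K_def isCont_def by (intro tendsto_vec_lambda) simp
  qed
  from GDERIV_caratheodory[OF diff this] show ?thesis by (auto simp: y_def)
qed

section \<open>Generating functions over words\<close>

lemma finite_words: "finite {w :: 'l::finite symbol list. length w = n}"
proof -
  have "(UNIV :: 'l symbol set) = insert SymB (range SymA)"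
    by (auto intro: symbol.exhaust)
  then have "finite (UNIV :: 'l symbol set)" by (metis finite_code finite_imageI finite_insert)
  from finite_lists_length_eq[OF this, of n] show ?thesis by simp
qed

lemma sum_symbol:
  fixes f :: "'l::finite symbol \<Rightarrow> 'b::comm_monoid_add"
  shows "(\<Sum>x\<in>UNIV. f x) = (\<Sum>l\<in>UNIV. f (SymA l)) + f SymB"
proof -
  have U: "(UNIV :: 'l symbol set) = insert SymB (range SymA)"
    by (auto intro: symbol.exhaust)
  have "(\<Sum>x\<in>range SymA. f x) = (\<Sum>l\<in>UNIV. f (SymA l))"
    by (subst sum.reindex) (auto simp: inj_def)
  then show ?thesis unfolding U by (subst sum.insert) (auto simp: add.commute)
qed

lemma inner_symbol_counts_Cons:
  "t \<bullet> symbol_counts (SymA l # w) = t $ l + t \<bullet> symbol_counts w"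
  "t \<bullet> symbol_counts (SymB # w) = t \<bullet> symbol_counts w"
proof -
  have "symbol_counts (SymA l # w) = axis l 1 + symbol_counts w"
    by (simp add: symbol_counts_def vec_eq_iff axis_def)
  then show "t \<bullet> symbol_counts (SymA l # w) = t $ l + t \<bullet> symbol_counts w"
    by (simp add: inner_add_right inner_axis)
qed (simp add: symbol_counts_def)

text \<open>Splitting off the first letter multiplies by \<open>exp (t $ l)\<close> times
  \<open>A l\<close>, or by \<open>B\<close>, which sum to the tilted matrix. The sum is kept
  vector-valued because a new letter acts from the left.\<close>

lemma sum_tilted_words:
  fixes A :: "'l::finite \<Rightarrow> real^'m^'m"
  shows "(\<Sum>w | length w = n. exp (t \<bullet> symbol_counts w) *\<^sub>R (word_matrix A B w *v \<eta>))
    = mat_pow (tilted_matrix A B t) n *v \<eta>"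
proof (induction n)
  case 0
  then show ?case by (simp add: symbol_counts_def inner_vec_def)
next
  case (Suc n)
  let ?W = "{w :: 'l symbol list. length w = n}"
  let ?z = "mat_pow (tilted_matrix A B t) n *v \<eta>"
  have eq: "{w :: 'l symbol list. length w = Suc n} = (\<lambda>(x, w). x # w) ` (UNIV \<times> ?W)"
    by (auto simp: length_Suc_conv image_iff)
  have "(\<Sum>w | length w = Suc n. exp (t \<bullet> symbol_counts w) *\<^sub>R (word_matrix A B w *v \<eta>))
      = (\<Sum>x\<in>UNIV. \<Sum>w\<in>?W. exp (t \<bullet> symbol_counts (x # w)) *\<^sub>R (word_matrix A B (x # w) *v \<eta>))"
    unfolding eq by (subst sum.reindex) (auto simp: inj_on_def sum.cartesian_product case_prod_unfold)
  also have "\<dots> = (\<Sum>l\<in>UNIV. exp (t $ l) *\<^sub>R (A l *v ?z)) + B *v ?z"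
  proof -
    have lin: "C *v ?z = (\<Sum>w\<in>?W. exp (t \<bullet> symbol_counts w) *\<^sub>R (C *v (word_matrix A B w *v \<eta>)))" for C
      unfolding Suc[symmetric] by (simp add: linear_sum linear_cmul)
    show ?thesis
      unfolding sum_symbol lin
      by (simp add: inner_symbol_counts_Cons exp_add matrix_vector_mul_assoc scaleR_sum_right)
  qed
  also have "\<dots> = tilted_matrix A B t *v ?z"
    by (simp add: tilted_matrix_vector)
  finally show ?case by (simp add: matrix_vector_mul_assoc)
qed

lemma nonneg_word_matrix:
  assumes "\<And>l. nonneg_mat (A l)" "nonneg_mat B"
  shows "nonneg_mat (word_matrix A B w)"
proof (induction w)
  case Nil
  then show ?case by (simp add: nonneg_mat_def mat_def)
next
  case (Cons x w)
  then show ?case using assms by (cases x) (auto intro: nonneg_mat_mult)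
qed

lemma integral_word_measure:
  fixes A :: "'l::finite \<Rightarrow> real^'m^'m"
  assumes A: "\<And>l. nonneg_mat (A l)" and B: "nonneg_mat B" and xi: "nonneg_vec \<xi>" and eta: "nonneg_vec \<eta>"
    and pos: "0 < \<xi> \<bullet> (mat_pow (sum_matrix A B) n *v \<eta>)"
  shows "(\<integral>w. exp (t \<bullet> symbol_counts w) \<partial>word_measure \<xi> A B \<eta> n)
    = (\<xi> \<bullet> (mat_pow (tilted_matrix A B t) n *v \<eta>)) / (\<xi> \<bullet> (mat_pow (sum_matrix A B) n *v \<eta>))"
proof -
  let ?Z = "\<xi> \<bullet> (mat_pow (sum_matrix A B) n *v \<eta>)"
  \<comment> \<open>Nonnegativity keeps \<open>ennreal\<close> in \<open>word_measure\<close> from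
    truncating a weight to zero.\<close>
  have nn: "0 \<le> word_weight \<xi> A B \<eta> w" for w
    unfolding word_weight_def
    by (intro inner_nonneg_vec xi nonneg_vec_mult nonneg_word_matrix A B eta)
  have "(\<integral>w. exp (t \<bullet> symbol_counts w) \<partial>word_measure \<xi> A B \<eta> n)
      = (\<Sum>w | length w = n. (word_weight \<xi> A B \<eta> w / ?Z) *\<^sub>R exp (t \<bullet> symbol_counts w))"
    unfolding word_measure_def
    by (rule lebesgue_integral_point_measure_finite) (use nn pos finite_words in auto)
  also have "\<dots> = (\<Sum>w | length w = n. \<xi> \<bullet> (exp (t \<bullet> symbol_counts w) *\<^sub>R (word_matrix A B w *v \<eta>))) / ?Z"
    by (simp add: word_weight_def sum_divide_distrib mult_ac)
  also have "\<dots> = (\<xi> \<bullet> (mat_pow (tilted_matrix A B t) n *v \<eta>)) / ?Z"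
    by (simp only: inner_sum_right[symmetric] sum_tilted_words)
  finally show ?thesis .
qed

lemma linear_representation_nonzero:
  assumes "linear_representation \<xi> A B \<eta>"
  shows "\<xi> \<noteq> 0" "\<eta> \<noteq> 0"
proof -
  have "\<forall>\<^sub>F n in sequentially. \<exists>w. length w = n \<and> 0 < word_weight \<xi> A B \<eta> w"
    using assms by (simp add: linear_representation_def)
  then obtain w where "0 < word_weight \<xi> A B \<eta> w"
    using eventually_happens'[OF sequentially_bot] by blast
  then show "\<xi> \<noteq> 0" "\<eta> \<noteq> 0" by (auto simp: word_weight_def)
qed

section \<open>From symbol statistics to the large deviation principle\<close>

text \<open>Exponential moments depend only on marginal laws, so they can be computed over words.
  There they are quotients of \<open>?Zt t n\<close> and \<open>?Z n\<close>, whose growth rates are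
  Perron-Frobenius eigenvalues.\<close>

lemma symbol_statistics_log_mgf_limit:
  fixes A :: "'l::finite \<Rightarrow> real^'m^'m" and Y :: "nat \<Rightarrow> 'w \<Rightarrow> real^'l"
  assumes rep: "linear_representation \<xi> A B \<eta>" and prim: "primitive_mat (sum_matrix A B)"
    and prob: "prob_space P" and Y: "symbol_statistics P \<xi> A B \<eta> Y"
  shows "log_mgf_limit P Y
    (\<lambda>t. ln (pf_eigenvalue (tilted_matrix A B t) / pf_eigenvalue (sum_matrix A B)))"
proof -
  interpret prob_space P by (rule prob)
  have A: "nonneg_mat (A l)" and B: "nonneg_mat B" and xi: "nonneg_vec \<xi>" and eta: "nonneg_vec \<eta>" for l
    using rep by (auto simp: linear_representation_def)
  note nz = linear_representation_nonzero[OF rep]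
  have primt: "primitive_mat (tilted_matrix A B t)" for t
    by (rule primitive_tilted_matrix[OF A B prim])
  let ?Z = "\<lambda>n. \<xi> \<bullet> (mat_pow (sum_matrix A B) n *v \<eta>)"
  let ?Zt = "\<lambda>t n. \<xi> \<bullet> (mat_pow (tilted_matrix A B t) n *v \<eta>)"
  note lim = ln_mat_pow_tendsto[OF primt xi nz(1) eta nz(2)]
  note lim0 = ln_mat_pow_tendsto[OF prim xi nz(1) eta nz(2)]
  have ev: "\<forall>\<^sub>F n in sequentially. Y n \<in> borel_measurable P \<and>
      distr P borel (Y n) = distr (word_measure \<xi> A B \<eta> n) borel symbol_counts"
    using Y by (simp add: symbol_statistics_def)
  have meas: "symbol_counts \<in> borel_measurable (word_measure \<xi> A B \<eta> n)" for n
    by (simp add: word_measure_def)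
  have int: "integrable P (\<lambda>\<omega>. exp (t \<bullet> Y n \<omega>))"
    if "Y n \<in> borel_measurable P" "distr P borel (Y n) = distr (word_measure \<xi> A B \<eta> n) borel symbol_counts" for n t
  proof -
    have "integrable (word_measure \<xi> A B \<eta> n) (\<lambda>w. exp (t \<bullet> symbol_counts w))"
      unfolding word_measure_def by (rule integrable_point_measure_finite[OF finite_words])
    then have "integrable (distr (word_measure \<xi> A B \<eta> n) borel symbol_counts) (\<lambda>x. exp (t \<bullet> x))"
      by (subst integrable_distr_eq[OF meas]) auto
    then show ?thesis
      unfolding that(2)[symmetric] by (subst (asm) integrable_distr_eq[OF that(1)]) auto
  qed
  have expect: "expectation (\<lambda>\<omega>. exp (t \<bullet> Y n \<omega>)) = ?Zt t n / ?Z n"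
    if "Y n \<in> borel_measurable P" "distr P borel (Y n) = distr (word_measure \<xi> A B \<eta> n) borel symbol_counts"
      "0 < ?Z n" for n t
  proof -
    have "expectation (\<lambda>\<omega>. exp (t \<bullet> Y n \<omega>)) = (\<integral>x. exp (t \<bullet> x) \<partial>distr P borel (Y n))"
      by (subst integral_distr[OF that(1)]) auto
    also have "\<dots> = (\<integral>w. exp (t \<bullet> symbol_counts w) \<partial>word_measure \<xi> A B \<eta> n)"
      unfolding that(2) by (subst integral_distr[OF meas]) auto
    also have "\<dots> = ?Zt t n / ?Z n"
      by (rule integral_word_measure[OF A B xi eta that(3)])
    finally show ?thesis .
  qed
  show ?thesis
  proof
    show "\<forall>\<^sub>F n in sequentially. Y n \<in> borel_measurable P"
      using ev by eventually_elim simp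
    show "\<forall>\<^sub>F n in sequentially. \<forall>t. integrable P (\<lambda>\<omega>. exp (t \<bullet> Y n \<omega>))"
      using ev by eventually_elim (auto intro: int)
    fix t
    have "(\<lambda>n. ln (?Zt t n) / real n - ln (?Z n) / real n) \<longlonglongrightarrow>
        ln (pf_eigenvalue (tilted_matrix A B t)) - ln (pf_eigenvalue (sum_matrix A B))"
      by (intro tendsto_diff lim(1) lim0(1))
    also have "ln (pf_eigenvalue (tilted_matrix A B t)) - ln (pf_eigenvalue (sum_matrix A B))
        = ln (pf_eigenvalue (tilted_matrix A B t) / pf_eigenvalue (sum_matrix A B))"
      using pf_eigenvalue_pos[OF primt, of t] pf_eigenvalue_pos[OF prim] by (subst ln_div) auto
    finally show "(\<lambda>n. ln (expectation (\<lambda>\<omega>. exp (t \<bullet> Y n \<omega>))) / real n)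
        \<longlonglongrightarrow> ln (pf_eigenvalue (tilted_matrix A B t) / pf_eigenvalue (sum_matrix A B))"
    \<comment> \<open>The two sequences agree once the law of \<open>Y n\<close> is prescribed and
      both \<open>?Zt t n\<close> and \<open>?Z n\<close> are positive.\<close>
    proof (rule Lim_transform_eventually)
      show "\<forall>\<^sub>F n in sequentially. ln (?Zt t n) / real n - ln (?Z n) / real n
          = ln (expectation (\<lambda>\<omega>. exp (t \<bullet> Y n \<omega>))) / real n"
        using ev lim(2)[of t] lim0(2)
        by eventually_elim (simp add: expect ln_div diff_divide_distrib)
    qed
  qed
qed

theorem theorem4:
  fixes \<xi> \<eta> :: "real^'m"
    and A :: "'l::finite \<Rightarrow> real^'m^'m"
    and B M :: "real^'m^'m"
    and P :: "'w measure"
    and Y :: "nat \<Rightarrow> 'w \<Rightarrow> real^'l"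
    and lambda :: real
    and y :: "real^'l \<Rightarrow> real"
    and \<beta> :: "real^'l"
    and G :: "real^'l \<Rightarrow> ereal"
  assumes rep: "linear_representation \<xi> A B \<eta>"
    and M: "M = sum_matrix A B"
    and prim: "primitive_mat M"
    and prob: "prob_space P"
    and Y: "symbol_statistics P \<xi> A B \<eta> Y"
    and lambda: "lambda = pf_eigenvalue M"
    and y: "y = (\<lambda>t. pf_eigenvalue (tilted_matrix A B t))"
    and \<beta>: "\<beta> = gradient y 0 /\<^sub>R lambda"
    and G: "G = (\<lambda>x. SUP t. ereal (t \<bullet> x - ln (y t / lambda)))"
  shows "good_rate_function G
       \<and> satisfies_LDP P (\<lambda>n \<omega>. Y n \<omega> /\<^sub>R real n) real G
       \<and> (AE \<omega> in P. (\<lambda>n. Y n \<omega> /\<^sub>R real n) \<longlonglongrightarrow> \<beta>)"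
proof -
  interpret log_mgf_limit P Y "\<lambda>t. ln (y t / lambda)"
    unfolding y lambda M
    by (rule symbol_statistics_log_mgf_limit[OF rep prim[unfolded M] prob Y])
  have primt: "primitive_mat (tilted_matrix A B t)" for t
    using rep prim by (intro primitive_tilted_matrix) (auto simp: linear_representation_def M)
  have y_pos: "0 < y t" for t
    unfolding y by (rule pf_eigenvalue_pos[OF primt])
  have lam: "0 < lambda" "y 0 = lambda"
    using pf_eigenvalue_pos[OF prim] by (simp_all add: lambda y M tilted_matrix_zero)
  have y_deriv: "\<exists>D. GDERIV y t :> D" for t
    unfolding y by (rule GDERIV_pf_eigenvalue_tilted[OF primt])
  have L_deriv: "GDERIV (\<lambda>t. ln (y t / lambda)) t :> (1 / y t) *\<^sub>R D" if "GDERIV y t :> D" for t D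
  proof (rule GDERIV_DERIV_compose[OF that])
    show "DERIV (\<lambda>z. ln (z / lambda)) (y t) :> 1 / y t"
      using lam y_pos[of t] by (auto intro!: derivative_eq_intros simp: field_simps)
  qed
  have diff: "\<exists>D. GDERIV (\<lambda>t. ln (y t / lambda)) t :> D" for t
    using y_deriv[of t] L_deriv by blast
  obtain D where D: "GDERIV y 0 :> D" using y_deriv by blast
  \<comment> \<open>By the chain rule the gradient at \<open>0\<close> is \<open>D\<close> divided
    by \<open>y 0\<close>, and \<open>y 0 = lambda\<close>.\<close>
  have "GDERIV (\<lambda>t. ln (y t / lambda)) 0 :> \<beta>"
    using L_deriv[OF D] by (simp add: \<beta> gradient_eqI[OF D] lam inverse_eq_divide)
  then have "AE \<omega> in P. (\<lambda>n. Y n \<omega> /\<^sub>R real n) \<longlonglongrightarrow> \<beta>"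
    by (rule AE_tendsto_gradient)
  moreover have "G = rate"
    by (simp add: G rate_def fun_eq_iff)
  ultimately show ?thesis
    using good_rate_function_rate gaertner_ellis[OF diff] by simp
qed

end
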